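(* There is a constant $C>0$, depending only on $N$, the $a_i$'s, the $\alpha_i$'s and $U$ (and in particular independent of $T$, $\phi$, $\mathcal R$, $\mathcal Z$, $u$, $\Psi$), such that $$\begin{aligned}\int_0^T\!\!\int_U\mathcal K|\nabla u|^2dxdt&\le C\Big\{\chi_1^2\phi\big(\|\bar u_0\|_{L^2}^2+\|u\|^2_{L^2(U\times(0,T))}\big)\\&\qquad+(1+\chi_1)^{2(2+a)}M_{\mathcal Z}^2\|u\|^4_{L^4(U\times(0,T))}+\mathcal E_0\Big\},\\ \int_0^T\!\!\int_U|\nabla u|^{2-a}dxdt&\le C\Big\{\chi_1^2\phi\big(\|\bar u_0\|_{L^2}^2+\|u\|^2_{L^2(U\times(0,T))}\big)\\&\qquad+(1+\chi_1)^{2(2+a)}\big(T+M_{\mathcal Z}^2\|u\|^4_{L^4(U\times(0,T))}\big)+\mathcal E_0\Big\}.\end{aligned}$$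
   Context: $N\ge1$ is an integer, $0=\alpha_0<\alpha_1<\dots<\alpha_N$ are real numbers, $a_0,\dots,a_N>0$ are constants, and $g(s)=\sum_{i=0}^N a_is^{\alpha_i}$ for $s\ge0$. $\vec k\in\mathbb R^3$ is a fixed unit vector, $\mathbf J$ is the $3\times3$ matrix with $\mathbf Jx=\vec k\times x$, and $\mathcal R\ge0$ is a constant. The function $F:\mathbb R^3\to\mathbb R^3$, $F(v)=g(|v|)v+\mathcal R\,\mathbf Jv$, is a $C^1$ bijection whose inverse $X=F^{-1}$ is also $C^1$. $a=\frac{\alpha_N}{1+\alpha_N}\in(0,1)$, $\chi_0=g(1)$, $\chi_1=\chi_0+\mathcal R$. $U\subset\mathbb R^3$ is a nonempty open bounded set with $C^1$ boundary $\Gamma$; $T>0$; $\phi>0$, $\mathcal G>0$, $\Omega\ge0$ are constants, $e_0:\mathbb R\to\mathbb R^3$ is smooth with $|e_0(t)|=1$, $\mathcal Z(x,t)=-\mathcal Ge_0(t)+\Omega^2\mathbf J^2x$, and $M_{\mathcal Z}=\sup_{\bar U\times[0,T]}|\mathcal Z|$. $u\in C^{2,1}_{x,t}(\bar U\times(0,T])\cap C(\bar U\times[0,T])$ (not necessarily non-negative) solves $\phi u_t=\nabla\cdot(X(\nabla u+u^2\mathcal Z))$ in $U\times(0,T]$, $u(x,0)=u_0(x)$ in $U$, $u=\psi$ on $\Gamma\times(0,T]$. $\Psi\in C^1(\bar U\times[0,T])$ is an extension of $\psi$, i.e. $\Psi=\psi$ on $\Gamma\times(0,T]$, and $\bar u_0=u_0-\Psi(\cdot,0)$.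 $\|\cdot\|_{L^2}$ is the norm of $L^2(U)$. The weight is $\mathcal K(x,t)=(1+|\nabla u(x,t)+u^2(x,t)\mathcal Z(x,t)|)^{-a}$, and $$\mathcal E_0=\int_0^T\!\!\int_U\big(\chi_1^{2(2+a)}|\nabla\Psi|^2+\phi\chi_1^2(|\Psi_t|^2+\Psi^2)\big)dxdt.$$ *)

theory Defs
  imports "HOL-Analysis.Analysis"
begin

definition grad :: "('a::real_inner \<Rightarrow> real) \<Rightarrow> 'a \<Rightarrow> 'a" where
  "grad f x = (THE D. GDERIV f x :> D)"

definition divergence :: "(real^'n \<Rightarrow> real^'n) \<Rightarrow> real^'n \<Rightarrow> real" where
  "divergence W x = (\<Sum>i\<in>UNIV. frechet_derivative W (at x) (axis i 1) $ i)"

text \<open>Time derivative of a function of \<open>(x, t)\<close> with \<open>t\<close> in the interval \<open>I\<close>; it is one-sided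
  at an end point of \<open>I\<close> that belongs to \<open>I\<close>.\<close>

definition time_deriv :: "real set \<Rightarrow> ('a \<Rightarrow> real \<Rightarrow> real) \<Rightarrow> 'a \<Rightarrow> real \<Rightarrow> real" where
  "time_deriv I f x t = vector_derivative (f x) (at t within I)"

definition C1_function :: "('a::real_inner \<Rightarrow> real) \<Rightarrow> bool" where
  "C1_function f \<longleftrightarrow> (\<exists>f'. (\<forall>x. GDERIV f x :> f' x) \<and> continuous_on UNIV f')"

definition smooth_curve :: "(real \<Rightarrow> 'a::real_normed_vector) \<Rightarrow> bool" where
  "smooth_curve f \<longleftrightarrow> (\<exists>D :: nat \<Rightarrow> real \<Rightarrow> 'a. D 0 = f \<and>
     (\<forall>n t. (D n has_vector_derivative D (Suc n) t) (at t)))"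

text \<open>Near each boundary point, \<open>U\<close> is, in suitable orthonormal coordinates,
  the part of a ball lying strictly above the graph of a \<open>C\<^sup>1\<close> function of two variables.\<close>

definition C1_boundary :: "(real^3) set \<Rightarrow> bool" where
  "C1_boundary U \<longleftrightarrow> (\<forall>p\<in>frontier U. \<exists>r>0. \<exists>(Q :: real^3 \<Rightarrow> real^3) (\<gamma> :: real^2 \<Rightarrow> real).
     orthogonal_transformation Q \<and> C1_function \<gamma> \<and>
     U \<inter> ball p r = {x \<in> ball p r. Q x $ 3 > \<gamma> (vector [Q x $ 1, Q x $ 2])})"

text \<open>The classes \<open>C\<^sup>1\<close> and \<open>C\<^sup>2\<^sup>,\<^sup>1\<close> (in \<open>x\<close> and \<open>t\<close>) on \<open>closure U \<times> I\<close>, for open \<open>U\<close>: the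
  derivatives exist on \<open>U \<times> I\<close>, and the function and these derivatives extend continuously to
  \<open>closure U \<times> I\<close>.\<close>

definition C1_cylinder :: "(real^'n) set \<Rightarrow> real set \<Rightarrow> (real^'n \<Rightarrow> real \<Rightarrow> real) \<Rightarrow> bool" where
  "C1_cylinder U I f \<longleftrightarrow>
     continuous_on (closure U \<times> I) (\<lambda>(x, t). f x t) \<and>
     (\<exists>(Df :: real^'n \<Rightarrow> real \<Rightarrow> real^'n) (ft :: real^'n \<Rightarrow> real \<Rightarrow> real).
        (\<forall>x\<in>U. \<forall>t\<in>I.
           GDERIV (\<lambda>y. f y t) x :> Df x t \<and>
           (f x has_real_derivative ft x t) (at t within I)) \<and>
        continuous_on (closure U \<times> I) (\<lambda>(x, t). Df x t) \<and>
        continuous_on (closure U \<times> I) (\<lambda>(x, t). ft x t))"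

definition C21_cylinder :: "(real^'n) set \<Rightarrow> real set \<Rightarrow> (real^'n \<Rightarrow> real \<Rightarrow> real) \<Rightarrow> bool" where
  "C21_cylinder U I f \<longleftrightarrow>
     continuous_on (closure U \<times> I) (\<lambda>(x, t). f x t) \<and>
     (\<exists>(Df :: real^'n \<Rightarrow> real \<Rightarrow> real^'n) (D2f :: real^'n \<Rightarrow> real \<Rightarrow> real^'n^'n)
        (ft :: real^'n \<Rightarrow> real \<Rightarrow> real).
        (\<forall>x\<in>U. \<forall>t\<in>I.
           GDERIV (\<lambda>y. f y t) x :> Df x t \<and>
           ((\<lambda>y. Df y t) has_derivative (\<lambda>h. D2f x t *v h)) (at x) \<and>
           (f x has_real_derivative ft x t) (at t within I)) \<and>
        continuous_on (closure U \<times> I) (\<lambda>(x, t). Df x t) \<and>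
        continuous_on (closure U \<times> I) (\<lambda>(x, t). D2f x t) \<and>
        continuous_on (closure U \<times> I) (\<lambda>(x, t). ft x t))"

definition L_norm :: "real \<Rightarrow> 'a::euclidean_space set \<Rightarrow> ('a \<Rightarrow> real) \<Rightarrow> real" where
  "L_norm p S f = (LINT z:S|lborel. \<bar>f z\<bar> powr p) powr (1 / p)"


text \<open>The case distinction is needed since \<open>0 powr 0 = 0\<close>, while \<open>s\<close> to the power
  \<open>\<alpha> 0 = 0\<close> is \<open>1\<close> also for \<open>s = 0\<close>.\<close>

definition g_fun :: "nat \<Rightarrow> (nat \<Rightarrow> real) \<Rightarrow> (nat \<Rightarrow> real) \<Rightarrow> real \<Rightarrow> real" where
  "g_fun N \<alpha> a s = (\<Sum>i\<le>N. a i * (if \<alpha> i = 0 then 1 else s powr \<alpha> i))"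

definition J_op :: "real^3 \<Rightarrow> real^3 \<Rightarrow> real^3" where
  "J_op k x = cross3 k x"

definition F_fun ::
    "nat \<Rightarrow> (nat \<Rightarrow> real) \<Rightarrow> (nat \<Rightarrow> real) \<Rightarrow> real^3 \<Rightarrow> real \<Rightarrow> real^3 \<Rightarrow> real^3" where
  "F_fun N \<alpha> a k R v = g_fun N \<alpha> a (norm v) *\<^sub>R v + R *\<^sub>R J_op k v"

definition X_fun ::
    "nat \<Rightarrow> (nat \<Rightarrow> real) \<Rightarrow> (nat \<Rightarrow> real) \<Rightarrow> real^3 \<Rightarrow> real \<Rightarrow> real^3 \<Rightarrow> real^3" where
  "X_fun N \<alpha> a k R = inv (F_fun N \<alpha> a k R)"

definition a_exp :: "nat \<Rightarrow> (nat \<Rightarrow> real) \<Rightarrow> real" where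
  "a_exp N \<alpha> = \<alpha> N / (1 + \<alpha> N)"

definition chi0 :: "nat \<Rightarrow> (nat \<Rightarrow> real) \<Rightarrow> (nat \<Rightarrow> real) \<Rightarrow> real" where
  "chi0 N \<alpha> a = g_fun N \<alpha> a 1"

definition chi1 :: "nat \<Rightarrow> (nat \<Rightarrow> real) \<Rightarrow> (nat \<Rightarrow> real) \<Rightarrow> real \<Rightarrow> real" where
  "chi1 N \<alpha> a R = chi0 N \<alpha> a + R"

definition Z_fun ::
    "real^3 \<Rightarrow> real \<Rightarrow> real \<Rightarrow> (real \<Rightarrow> real^3) \<Rightarrow> real^3 \<Rightarrow> real \<Rightarrow> real^3" where
  "Z_fun k G \<Omega> e0 x t = - (G *\<^sub>R e0 t) + \<Omega>\<^sup>2 *\<^sub>R J_op k (J_op k x)"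

definition M_Z :: "(real^3) set \<Rightarrow> real \<Rightarrow> (real^3 \<Rightarrow> real \<Rightarrow> real^3) \<Rightarrow> real" where
  "M_Z U T Z = (SUP (x, t) \<in> closure U \<times> {0..T}. norm (Z x t))"

definition flux_arg ::
    "(real^3 \<Rightarrow> real \<Rightarrow> real^3) \<Rightarrow> (real^3 \<Rightarrow> real \<Rightarrow> real) \<Rightarrow> real^3 \<Rightarrow> real \<Rightarrow> real^3" where
  "flux_arg Z u x t = grad (\<lambda>y. u y t) x + (u x t)\<^sup>2 *\<^sub>R Z x t"

definition K_weight ::
    "real \<Rightarrow> (real^3 \<Rightarrow> real \<Rightarrow> real^3) \<Rightarrow> (real^3 \<Rightarrow> real \<Rightarrow> real) \<Rightarrow> real^3 \<Rightarrow> real \<Rightarrow> real" where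
  "K_weight b Z u x t = (1 + norm (flux_arg Z u x t)) powr (- b)"

definition classical_solution ::
    "(real^3) set \<Rightarrow> real \<Rightarrow> real \<Rightarrow> (real^3 \<Rightarrow> real^3) \<Rightarrow> (real^3 \<Rightarrow> real \<Rightarrow> real^3) \<Rightarrow>
     (real^3 \<Rightarrow> real) \<Rightarrow> (real^3 \<Rightarrow> real \<Rightarrow> real) \<Rightarrow> (real^3 \<Rightarrow> real \<Rightarrow> real) \<Rightarrow> bool" where
  "classical_solution U T \<phi> X Z u0 \<psi> u \<longleftrightarrow>
     C21_cylinder U {0<..T} u \<and>
     continuous_on (closure U \<times> {0..T}) (\<lambda>(x, t). u x t) \<and>
     (\<forall>x\<in>U. \<forall>t\<in>{0<..T}.
        \<phi> * time_deriv {0<..T} u x t = divergence (\<lambda>y. X (flux_arg Z u y t)) x) \<and>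
     (\<forall>x\<in>U. u x 0 = u0 x) \<and>
     (\<forall>x\<in>frontier U. \<forall>t\<in>{0<..T}. u x t = \<psi> x t)"

definition E0_data ::
    "(real^3) set \<Rightarrow> real \<Rightarrow> real \<Rightarrow> real \<Rightarrow> real \<Rightarrow> (real^3 \<Rightarrow> real \<Rightarrow> real) \<Rightarrow> real" where
  "E0_data U T \<phi> b c1 \<Psi> =
     (LINT t:{0<..<T}|lborel. (LINT x:U|lborel. (
        c1 powr (2 * (2 + b)) * (norm (grad (\<lambda>y. \<Psi> y t) x))\<^sup>2 +
        \<phi> * c1\<^sup>2 * (\<bar>time_deriv {0..T} \<Psi> x t\<bar>\<^sup>2 + (\<Psi> x t)\<^sup>2))))"

end

theory Submission
  imports Defs
begin

text \<open>Test the equation with \<open>w = u - \<Psi>\<close>, which vanishes on the boundary. The field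
  \<open>w X(\<nabla>u + u\<^sup>2 Z)\<close>, extended by zero, is globally Lipschitz, so its divergence has integral
  zero by translation invariance of difference quotients; no boundary regularity beyond
  \<open>frontier U\<close> being a null set enters. The map \<open>F\<close> is strongly monotone with constant \<open>a 0\<close>,
  hence its inverse \<open>X\<close> is a Lipschitz differentiable map with
  \<open>K |y|\<^sup>2 \<le> c \<chi>\<^sub>1\<^sup>2 X(y) \<bullet> y\<close> and \<open>a 0 |X(y)|\<^sup>2 \<le> X(y) \<bullet> y\<close>; the second bound absorbs
  the terms with \<open>u\<^sup>2 Z\<close> and \<open>\<nabla>\<Psi>\<close>. Integration over \<open>[\<tau>, T]\<close> and \<open>\<tau> \<rightarrow> 0\<close> give the
  weighted estimate, and \<open>|p| powr (2 - b) \<le> 2 K |p|\<^sup>2 + 2 + 2 u\<^sup>4 |Z|\<^sup>2\<close> the second one.\<close>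

section \<open>The Forchheimer map and its inverse\<close>

text \<open>The constant must not see \<open>R\<close>. The rotation is orthogonal to
  \<open>v\<close>, so it adds nothing to \<open>F(v) . v = g(|v|) |v|^2\<close>, yet it may
  lengthen \<open>F(v)\<close> by up to \<open>R |v|\<close>; the factor \<open>chi1^2\<close> pays
  for this loss, and elsewhere \<open>R\<close> is removed through \<open>chi0 \<le> chi1\<close>.
  The exponent \<open>a_exp\<close> is the rate at which \<open>g(|v|)\<close> grows with
  \<open>|F(v)|\<close>, so the weight cancels one of the two factors \<open>g\<close> in
  \<open>|F(v)|^2\<close>. Since the norm of \<open>u\<close> is allowed on the right, the term with
  \<open>w\<close> and the time derivative of \<open>\<Psi>\<close> is bounded by squares, and the
  inequality closes by one integration in time. Two obstacles shape the analysis. The derivatives of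
  \<open>u\<close> are not controlled as \<open>t\<close> tends to \<open>0\<close>, so the left
  sides are integrals with values up to infinity, whose finiteness is part of the conclusion. And
  \<open>X\<close> is shown to be differentiable with a bounded derivative only, so the integration
  by parts asks for pointwise derivatives with a uniform bound instead of continuous ones.\<close>

locale forchheimer =
  fixes N :: nat and \<alpha> a :: "nat \<Rightarrow> real"
  assumes N_ge_1: "N \<ge> 1" and alpha_0: "\<alpha> 0 = 0" and alpha_mono: "strict_mono_on {..N} \<alpha>"
    and a_pos: "\<forall>i\<le>N. a i > 0"
begin

abbreviation g :: "real \<Rightarrow> real" where "g \<equiv> g_fun N \<alpha> a"

abbreviation F :: "real^3 \<Rightarrow> real \<Rightarrow> real^3 \<Rightarrow> real^3" where "F \<equiv> F_fun N \<alpha> a"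

abbreviation X :: "real^3 \<Rightarrow> real \<Rightarrow> real^3 \<Rightarrow> real^3" where "X \<equiv> X_fun N \<alpha> a"

lemma a0_pos: "a 0 > 0"
  using a_pos by simp

lemma a_nonneg: "i \<le> N \<Longrightarrow> 0 \<le> a i"
  using a_pos by (simp add: less_imp_le)

lemma alpha_pos: "0 < i \<Longrightarrow> i \<le> N \<Longrightarrow> \<alpha> i > 0"
  using strict_mono_onD[OF alpha_mono, of 0 i] alpha_0 by simp

lemma alpha_nonneg: "i \<le> N \<Longrightarrow> \<alpha> i \<ge> 0"
  using alpha_pos[of i] alpha_0 by (cases "i = 0") auto

lemma alpha_N_pos: "\<alpha> N > 0"
  using alpha_pos[of N] N_ge_1 by simp

lemma alpha_le_N: "i \<le> N \<Longrightarrow> \<alpha> i \<le> \<alpha> N"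
  using strict_mono_onD[OF alpha_mono, of i N] by (cases "i = N") auto

lemma a_exp_bounds: "0 < a_exp N \<alpha>" "a_exp N \<alpha> < 1"
  using alpha_N_pos by (auto simp: a_exp_def)

section \<open>Growth of \<open>g\<close> in terms of \<open>s * g s\<close>\<close>

lemma g_mono: "0 \<le> s \<Longrightarrow> s \<le> t \<Longrightarrow> g s \<le> g t"
  unfolding g_fun_def
  by (intro sum_mono mult_left_mono) (auto intro!: powr_mono2 simp: alpha_nonneg a_nonneg)

lemma g_0: "g 0 = a 0"
proof -
  have "g 0 = (\<Sum>i\<le>N. if i = 0 then a 0 else 0)"
    unfolding g_fun_def
  proof (intro sum.cong refl)
    fix i assume "i \<in> {..N}"
    then show "a i * (if \<alpha> i = 0 then 1 else 0 powr \<alpha> i) = (if i = 0 then a 0 else 0)"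
      using alpha_0 alpha_pos[of i] by (cases "i = 0") auto
  qed
  then show ?thesis by simp
qed

lemma g_ge_a0: "0 \<le> s \<Longrightarrow> a 0 \<le> g s"
  using g_mono[of 0 s] g_0 by simp

lemma g_pos: "0 \<le> s \<Longrightarrow> 0 < g s"
  using g_ge_a0[of s] a0_pos by simp

lemma chi0_pos: "chi0 N \<alpha> a > 0"
  unfolding chi0_def by (rule g_pos) simp

lemma continuous_on_g: "continuous_on {0..} g"
  unfolding g_fun_def
proof (intro continuous_intros)
  fix i assume "i \<in> {..N}"
  then show "continuous_on {0..} (\<lambda>s. if \<alpha> i = 0 then 1 else s powr \<alpha> i)"
    using alpha_nonneg[of i]
    by (cases "\<alpha> i = 0") (auto intro!: continuous_on_powr' continuous_on_id continuous_on_const)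
qed

text \<open>Powers of \<open>1 + s\<close>, unlike those of \<open>s\<close>, are monotone in the
  exponent; so the top power dominates every term, and the coefficients sum to
  \<open>g 1\<close>.\<close>

lemma g_le: "0 \<le> s \<Longrightarrow> g s \<le> chi0 N \<alpha> a * (1 + s) powr \<alpha> N"
proof -
  assume s: "0 \<le> s"
  have "a i * (if \<alpha> i = 0 then 1 else s powr \<alpha> i) \<le> a i * (1 + s) powr \<alpha> N" if i: "i \<le> N" for i
  proof (intro mult_left_mono)
    have "s powr \<alpha> i \<le> (1 + s) powr \<alpha> i" using s alpha_nonneg[OF i] by (intro powr_mono2) auto
    also have "\<dots> \<le> (1 + s) powr \<alpha> N" using s alpha_le_N[OF i] by (intro powr_mono) auto
    finally have "s powr \<alpha> i \<le> (1 + s) powr \<alpha> N" .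
    moreover have "1 \<le> (1 + s) powr \<alpha> N" using s alpha_N_pos by (intro ge_one_powr_ge_zero) auto
    ultimately show "(if \<alpha> i = 0 then 1 else s powr \<alpha> i) \<le> (1 + s) powr \<alpha> N" by simp
  qed (use a_pos i in force)
  then have "g s \<le> (\<Sum>i\<le>N. a i * (1 + s) powr \<alpha> N)"
    unfolding g_fun_def by (intro sum_mono) auto
  also have "\<dots> = chi0 N \<alpha> a * (1 + s) powr \<alpha> N"
    by (simp add: chi0_def g_fun_def sum_distrib_right if_distrib cong: if_cong)
  finally show ?thesis .
qed

text \<open>The top term alone gives \<open>a N * s powr (1 + \<alpha> N) \<le> s * g s\<close>.
  This is useless for small \<open>s\<close>, hence the additive \<open>1\<close> and the comparison
  of \<open>1 + s\<close> with \<open>2 * max 1 s\<close>.\<close>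

lemma power_le_sg:
  assumes s: "0 \<le> s"
  shows "(1 + s) powr (1 + \<alpha> N) \<le> 2 powr (1 + \<alpha> N) * (1 + 1 / a N) * (1 + s * g s)"
proof -
  have aN: "a N > 0" using a_pos by simp
  let ?p = "1 + \<alpha> N"
  have gs: "a N * s powr \<alpha> N \<le> g s"
  proof -
    have "a N * s powr \<alpha> N = a N * (if \<alpha> N = 0 then 1 else s powr \<alpha> N)"
      using alpha_N_pos by simp
    also have "\<dots> \<le> g s"
      unfolding g_fun_def
      by (rule member_le_sum[where f = "\<lambda>i. a i * (if \<alpha> i = 0 then 1 else s powr \<alpha> i)"])
         (auto intro!: mult_nonneg_nonneg simp: a_nonneg)
    finally show ?thesis .
  qed
  have sp: "s powr ?p = s * s powr \<alpha> N"
    using s by (cases "s = 0") (auto simp: powr_add)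
  have "(1 + s) powr ?p \<le> (2 * max 1 s) powr ?p"
    using s alpha_N_pos by (intro powr_mono2) auto
  also have "\<dots> = 2 powr ?p * (max 1 s) powr ?p" by (simp add: powr_mult)
  also have "(max 1 s) powr ?p \<le> 1 + s powr ?p" by (auto simp: max_def)
  also have "1 + s powr ?p \<le> 1 + s * g s / a N"
  proof -
    have "s * (a N * s powr \<alpha> N) \<le> s * g s" using gs s by (rule mult_left_mono)
    then show ?thesis using aN sp by (simp add: field_simps)
  qed
  also have "1 + s * g s / a N \<le> (1 + 1 / a N) * (1 + s * g s)"
    using aN s g_pos[OF s] by (simp add: field_simps)
  finally show ?thesis by (simp add: mult.assoc mult_left_mono)
qed

text \<open>The factor of \<open>g_le\<close> times that of \<open>power_le_sg\<close> raised to
  \<open>a_exp N \<alpha>\<close>.\<close>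

definition growth :: real where
  "growth = chi0 N \<alpha> a * (2 powr (1 + \<alpha> N) * (1 + 1 / a N)) powr a_exp N \<alpha>"

lemma growth_pos: "growth > 0"
proof -
  have "a N > 0" using a_pos by simp
  then have "2 powr (1 + \<alpha> N) * (1 + 1 / a N) > 0" by (auto intro!: mult_pos_pos add_pos_pos)
  then show ?thesis 
    unfolding growth_def using chi0_pos by (metis less_irrefl mult_pos_pos powr_gt_zero)
qed

text \<open>Here the exponent of the weight originates:
  \<open>(1 + \<alpha> N) * a_exp N \<alpha> = \<alpha> N\<close>, so raising
  \<open>power_le_sg\<close> to this power recovers the growth of \<open>g\<close>. As
  \<open>s * g s\<close> is at most \<open>|F(v)|\<close> when \<open>|v| = s\<close>, the bound
  passes on to powers of \<open>1 + |F(v)|\<close>.\<close>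

lemma g_le_growth:
  assumes s: "0 \<le> s"
  shows "g s \<le> growth * (1 + s * g s) powr a_exp N \<alpha>"
proof -
  have aN: "a N > 0" using a_pos by simp
  let ?p = "1 + \<alpha> N" and ?b = "a_exp N \<alpha>"
  have pb: "?p * ?b = \<alpha> N" using alpha_N_pos by (simp add: a_exp_def)
  have "(1 + s) powr \<alpha> N = ((1 + s) powr ?p) powr ?b"
    by (simp add: powr_powr pb)
  also have "\<dots> \<le> (2 powr ?p * (1 + 1 / a N) * (1 + s * g s)) powr ?b"
    using power_le_sg[OF s] a_exp_bounds by (intro powr_mono2) auto
  also have "\<dots> = (2 powr ?p * (1 + 1 / a N)) powr ?b * (1 + s * g s) powr ?b"
    using aN s g_pos[OF s] by (subst powr_mult) auto
  finally have "chi0 N \<alpha> a * (1 + s) powr \<alpha> N \<le> growth * (1 + s * g s) powr ?b"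
    using chi0_pos by (simp add: growth_def mult.assoc mult_left_mono)
  then show ?thesis using g_le[OF s] by linarith
qed

section \<open>Coercivity and strong monotonicity of \<open>F\<close>\<close>

lemma F_inner_self: "F k R v \<bullet> v = g (norm v) * (norm v)\<^sup>2"
  by (simp add: F_fun_def J_op_def inner_add_left dot_cross_self power2_norm_eq_inner)

lemma norm_J_op_le: "norm (J_op k v) \<le> norm k * norm v"
  by (rule power2_le_imp_le) (simp_all add: J_op_def norm_cross power_mult_distrib)

lemma norm_F_le:
  assumes "norm k = 1" "R \<ge> 0"
  shows "norm (F k R v) \<le> (g (norm v) + R) * norm v"
proof -
  have "norm (F k R v) \<le> g (norm v) * norm v + R * norm (J_op k v)"
    unfolding F_fun_def
    by (rule order_trans[OF norm_triangle_ineq]) (use g_pos[of "norm v"] assms in \<open>auto simp: less_imp_le\<close>)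
  also have "R * norm (J_op k v) \<le> R * norm v"
    using norm_J_op_le[of k v] assms by (intro mult_left_mono) auto
  finally show ?thesis by (simp add: algebra_simps)
qed

lemma norm_F_ge: "g (norm v) * norm v \<le> norm (F k R v)"
proof (cases "v = 0")
  case False
  have "norm v * (g (norm v) * norm v) = F k R v \<bullet> v"
    by (simp add: F_inner_self power2_eq_square)
  also have "\<dots> \<le> norm v * norm (F k R v)"
    using norm_cauchy_schwarz[of "F k R v" v] by (simp add: mult.commute)
  finally show ?thesis using False by simp
qed simp

text \<open>The factor \<open>growth\<close> pays for the \<open>g\<close> that the weight cancels.
  The square stems from \<open>1 + R / a 0 \<le> chi1 * (1 / chi0 + 1 / a 0)\<close>, which turns
  the rotation into a factor \<open>chi1\<close> with no other trace of \<open>R\<close>.\<close>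

definition coercivity :: real where
  "coercivity = growth * (1 / chi0 N \<alpha> a + 1 / a 0)\<^sup>2"

lemma coercivity_pos: "coercivity > 0"
  unfolding coercivity_def
  using growth_pos chi0_pos a0_pos by (intro mult_pos_pos zero_less_power add_pos_pos) simp_all

text \<open>From \<open>g + R \<le> g * (1 + R / a 0)\<close> the length of \<open>F(v)\<close> is
  at most a multiple of \<open>chi1 * g * |v|\<close>. In its square one factor \<open>g\<close> is
  cancelled by the weight, and what remains is \<open>g |v|^2\<close>, which is
  \<open>F(v) . v\<close>.\<close>

lemma F_coercive:
  assumes k: "norm k = 1" and R: "R \<ge> 0"
  shows "(1 + norm (F k R v)) powr (- a_exp N \<alpha>) * (norm (F k R v))\<^sup>2
      \<le> coercivity * (chi1 N \<alpha> a R)\<^sup>2 * (F k R v \<bullet> v)"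
proof -
  let ?b = "a_exp N \<alpha>" and ?s = "norm v" and ?y = "norm (F k R v)" and ?c = "chi1 N \<alpha> a R"
  let ?E = "1 / chi0 N \<alpha> a + 1 / a 0"
  have c: "?c = chi0 N \<alpha> a + R" by (simp add: chi1_def)
  have gp: "g ?s > 0" and ga: "a 0 \<le> g ?s" using g_pos[of ?s] g_ge_a0[of ?s] by auto
  have E: "?E > 0" using chi0_pos a0_pos by (simp add: add_pos_pos)
  have cE: "1 + R / a 0 \<le> ?c * ?E"
    using chi0_pos a0_pos R by (simp add: c field_simps)
  have "R \<le> g ?s * (R / a 0)"
    using mult_right_mono[OF ga, of "R / a 0"] a0_pos R by simp
  then have "g ?s + R \<le> g ?s * (1 + R / a 0)" by (simp add: algebra_simps)
  also have "\<dots> \<le> g ?s * (?c * ?E)" using cE gp by (intro mult_left_mono) auto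
  finally have "(g ?s + R) * ?s \<le> g ?s * (?c * ?E) * ?s" by (intro mult_right_mono) auto
  then have "?y \<le> g ?s * (?c * ?E) * ?s" using norm_F_le[OF k R, of v] by linarith
  then have y2: "?y\<^sup>2 \<le> (g ?s * (?c * ?E) * ?s)\<^sup>2" by (intro power_mono) auto
  have "g ?s \<le> growth * (1 + ?s * g ?s) powr ?b" by (rule g_le_growth) simp
  also have "\<dots> \<le> growth * (1 + ?y) powr ?b"
    using growth_pos norm_F_ge[of v k R] a_exp_bounds gp
    by (intro mult_left_mono powr_mono2) (auto simp: mult.commute intro!: add_nonneg_nonneg)
  finally have g1: "g ?s * (1 + ?y) powr (- ?b) \<le> growth"
    by (simp add: powr_minus divide_inverse[symmetric] pos_divide_le_eq add_pos_nonneg add_nonneg_eq_0_iff)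
  have "(1 + ?y) powr (- ?b) * ?y\<^sup>2 \<le> (1 + ?y) powr (- ?b) * (g ?s * (?c * ?E) * ?s)\<^sup>2"
    using y2 by (intro mult_left_mono) auto
  also have "\<dots> = (g ?s * (1 + ?y) powr (- ?b)) * (?E\<^sup>2 * ?c\<^sup>2 * (g ?s * ?s\<^sup>2))"
    by (simp add: power_mult_distrib power2_eq_square[of "g ?s"])
  also have "\<dots> \<le> growth * (?E\<^sup>2 * ?c\<^sup>2 * (g ?s * ?s\<^sup>2))"
    using g1 gp by (intro mult_right_mono) auto
  finally show ?thesis by (simp add: coercivity_def F_inner_self mult_ac)
qed

text \<open>The difference of the rotation terms is orthogonal to \<open>v - w\<close>. After
  splitting off \<open>a 0\<close>, the radial factor \<open>g - a 0\<close> is still nonnegative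
  and nondecreasing, and Cauchy-Schwarz reduces the claim to the scalar fact
  \<open>(G p - H q) (p - q) \<ge> 0\<close> for the lengths \<open>p\<close>,
  \<open>q\<close>.\<close>

lemma F_strong_mono: "a 0 * (norm (v - w))\<^sup>2 \<le> (F k R v - F k R w) \<bullet> (v - w)"
proof -
  define p q where "p = norm v" and "q = norm w"
  define G H where "G = g p - a 0" and "H = g q - a 0"
  have pq: "p \<ge> 0" "q \<ge> 0" by (auto simp: p_def q_def)
  have GH: "G \<ge> 0" "H \<ge> 0" using g_ge_a0 pq by (auto simp: G_def H_def)
  have J: "(J_op k v - J_op k w) \<bullet> (v - w) = 0"
    by (simp add: J_op_def dot_cross_self flip: Cross3.right_diff_distrib)
  have F: "F k R v - F k R w
      = a 0 *\<^sub>R (v - w) + (G *\<^sub>R v - H *\<^sub>R w) + R *\<^sub>R (J_op k v - J_op k w)"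
    by (simp add: F_fun_def G_def H_def p_def q_def algebra_simps)
  have "(G *\<^sub>R v - H *\<^sub>R w) \<bullet> (v - w) = G * p\<^sup>2 + H * q\<^sup>2 - (G + H) * (v \<bullet> w)"
    by (simp add: inner_diff_left inner_diff_right p_def q_def power2_norm_eq_inner inner_commute
        algebra_simps)
  moreover have "(G + H) * (v \<bullet> w) \<le> (G + H) * (p * q)"
    using GH norm_cauchy_schwarz[of v w] by (intro mult_left_mono) (auto simp: p_def q_def)
  moreover have "G * p\<^sup>2 + H * q\<^sup>2 - (G + H) * (p * q) = (G * p - H * q) * (p - q)"
    by (simp add: algebra_simps power2_eq_square)
  moreover have "0 \<le> (G * p - H * q) * (p - q)"
  proof (cases "p \<le> q")
    case True
    then have "G \<le> H" using g_mono[of p q] pq by (simp add: G_def H_def)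
    then have "G * p \<le> H * q" using True pq GH by (intro mult_mono) auto
    then show ?thesis using True by (intro mult_nonpos_nonpos) auto
  next
    case False
    then have "H \<le> G" using g_mono[of q p] pq by (simp add: G_def H_def)
    then have "H * q \<le> G * p" using False pq GH by (intro mult_mono) auto
    then show ?thesis using False by (intro mult_nonneg_nonneg) auto
  qed
  ultimately have "0 \<le> (G *\<^sub>R v - H *\<^sub>R w) \<bullet> (v - w)" by linarith
  then show ?thesis
    by (simp add: F inner_add_left J power2_norm_eq_inner)
qed

lemma F_expanding: "a 0 * norm (v - w) \<le> norm (F k R v - F k R w)"
proof (cases "v = w")
  case False
  have "norm (v - w) * (a 0 * norm (v - w)) \<le> (F k R v - F k R w) \<bullet> (v - w)"
    using F_strong_mono[of v w k R] by (simp add: power2_eq_square mult_ac)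
  also have "\<dots> \<le> norm (v - w) * norm (F k R v - F k R w)"
    using norm_cauchy_schwarz[of "F k R v - F k R w" "v - w"] by (simp add: mult.commute)
  finally show ?thesis using False by simp
qed simp

section \<open>Differentiability of \<open>F\<close>, and the inverse map \<open>X\<close>\<close>

lemma F_differentiable: "F k R differentiable (at v)"
proof -
  have J: "(\<lambda>v. R *\<^sub>R J_op k v) differentiable (at v)"
    by (intro linear_imp_differentiable linearI)
       (simp_all add: J_op_def cross_add_right cross_mult_right scaleR_add_right)
  have G: "(\<lambda>v::real^3. g (norm v) *\<^sub>R v) differentiable (at v)"
  proof (cases "v = 0")
    case False
    show ?thesis
      unfolding g_fun_def
    proof (intro differentiable_scaleR differentiable_ident differentiable_sum differentiable_mult
        differentiable_const finite_atMost ballI)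
      fix i assume "i \<in> {..N}"
      have "((\<lambda>v::real^3. norm v powr \<alpha> i) has_derivative
           (\<lambda>h. norm v powr \<alpha> i * ((0 * ln (norm v)) + (h \<bullet> sgn v) * \<alpha> i / norm v))) (at v within UNIV)"
        by (rule has_derivative_powr[OF has_derivative_norm has_derivative_const]) (use False in auto)
      then show "(\<lambda>x::real^3. if \<alpha> i = 0 then 1 else norm x powr \<alpha> i) differentiable at v"
        using differentiableI by (cases "\<alpha> i = 0") auto
    qed
  next
    case True
    \<comment> \<open>The norm is not differentiable at the origin, nor need its powers be, but the
      factor \<open>v\<close> helps: with derivative \<open>a 0\<close> times the identity, the
      error quotient has length at most the distance of \<open>g (norm y)\<close> from
      \<open>a 0\<close>, and \<open>g\<close> is continuous at \<open>0\<close>.\<close>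
    have "((\<lambda>v::real^3. g (norm v) *\<^sub>R v) has_derivative (\<lambda>h. a 0 *\<^sub>R h)) (at 0)"
    proof (rule has_derivativeI)
      have "continuous_on UNIV (\<lambda>v::real^3. g (norm v))"
        by (rule continuous_on_compose2[OF continuous_on_g]) (auto intro!: continuous_intros)
      then have "isCont (\<lambda>v::real^3. g (norm v)) 0" by (simp add: continuous_on_eq_continuous_at)
      then have "((\<lambda>v::real^3. g (norm v)) \<longlongrightarrow> a 0) (at 0)"
        by (simp add: isCont_def g_0)
      then have lim: "((\<lambda>v::real^3. norm (g (norm v) - a 0)) \<longlongrightarrow> 0) (at 0)"
        by (intro tendsto_norm_zero LIM_zero)
      show "((\<lambda>y::real^3. (g (norm y) *\<^sub>R y - g (norm (0::real^3)) *\<^sub>R 0 - a 0 *\<^sub>R (y - 0)) /\<^sub>R norm (y - 0)) \<longlongrightarrow> 0) (at 0)"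
      proof (rule Lim_null_comparison[OF _ lim], intro always_eventually allI)
        fix y :: "real^3"
        have "g (norm y) *\<^sub>R y - g (norm (0::real^3)) *\<^sub>R 0 - a 0 *\<^sub>R (y - 0) = (g (norm y) - a 0) *\<^sub>R y"
          by (simp add: scaleR_diff_left)
        then show "norm ((g (norm y) *\<^sub>R y - g (norm (0::real^3)) *\<^sub>R 0 - a 0 *\<^sub>R (y - 0)) /\<^sub>R norm (y - 0))
            \<le> norm (g (norm y) - a 0)"
          by (simp add: divide_simps)
      qed
    qed (auto intro: bounded_linear_scaleR_right)
    then show ?thesis using True differentiableI by blast
  qed
  show ?thesis unfolding F_fun_def using differentiable_add[OF G J] .
qed

lemma inj_F: "inj (F k R)"
proof (rule injI)
  fix v w assume "F k R v = F k R w"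
  then have "a 0 * norm (v - w) \<le> 0" using F_expanding[of v w k R] by simp
  then show "v = w" using a0_pos by (simp add: mult_le_0_iff)
qed

text \<open>The range of \<open>F\<close> is open by invariance of domain, and closed since \<open>F\<close> is expanding.\<close>

lemma surj_F: "surj (F k R)"
proof -
  have cont: "continuous_on UNIV (F k R)"
    by (intro differentiable_imp_continuous_on differentiable_at_imp_differentiable_on F_differentiable)
  have "open (range (F k R))"
    by (rule invariance_of_domain[OF cont open_UNIV inj_F])
  moreover have "closed (range (F k R))"
    unfolding closed_sequential_limits
  proof (intro allI impI, elim conjE)
    fix y l assume "\<forall>n. y n \<in> range (F k R)" and lim: "y \<longlonglongrightarrow> l"
    then have "\<forall>n. \<exists>x. y n = F k R x" by (simp add: image_iff)
    then obtain x where x: "\<And>n. y n = F k R (x n)" by metis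
    have "Cauchy x"
    proof (rule metric_CauchyI)
      fix e :: real assume "e > 0"
      then have "a 0 * e > 0" using a0_pos by simp
      then obtain M where M: "\<And>m n. m \<ge> M \<Longrightarrow> n \<ge> M \<Longrightarrow> dist (y m) (y n) < a 0 * e"
        using metric_CauchyD[OF LIMSEQ_imp_Cauchy[OF lim], of "a 0 * e"] by metis
      have "dist (x m) (x n) < e" if "m \<ge> M" "n \<ge> M" for m n
      proof -
        have "a 0 * dist (x m) (x n) < a 0 * e"
          using F_expanding[of "x m" "x n" k R] M[OF that] by (simp add: dist_norm x)
        then show ?thesis using a0_pos by simp
      qed
      then show "\<exists>M. \<forall>m\<ge>M. \<forall>n\<ge>M. dist (x m) (x n) < e" by blast
    qed
    then obtain z where "x \<longlonglongrightarrow> z" unfolding Cauchy_convergent_iff convergent_def by (elim exE)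
    then have "y \<longlonglongrightarrow> F k R z"
      using continuous_on_tendsto_compose[OF cont, of x z sequentially] by (simp flip: x)
    then have "l = F k R z" by (rule LIMSEQ_unique[OF lim])
    then show "l \<in> range (F k R)" by simp
  qed
  ultimately have "range (F k R) = {} \<or> range (F k R) = UNIV" by (simp only: clopen[symmetric])
  then show ?thesis by simp
qed

lemma F_X: "F k R (X k R y) = y"
  unfolding X_fun_def using surj_F by (rule surj_f_inv_f)

lemma X_lipschitz: "norm (X k R y - X k R z) \<le> norm (y - z) / a 0"
  using F_expanding[of "X k R y" "X k R z" k R] a0_pos by (simp add: F_X field_simps)

lemma continuous_X: "continuous_on S (X k R)"
  by (rule lipschitz_on_continuous_on[where L = "1 / a 0"])
     (use X_lipschitz a0_pos in \<open>auto intro!: lipschitz_onI simp: dist_norm\<close>)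

text \<open>Strong monotonicity passes to the derivative \<open>D\<close> of \<open>F\<close> as
  \<open>a 0 |h|^2 \<le> D h . h\<close>. So \<open>D\<close> is injective, hence invertible in
  finite dimension, with inverse bounded by \<open>1 / a 0\<close>; and a continuous inverse is
  differentiable wherever the derivative of the map is invertible.\<close>

lemma X_has_derivative:
  obtains D where "(X k R has_derivative D) (at y)" "\<And>h. norm (D h) \<le> norm h / a 0"
proof -
  obtain D where D: "(F k R has_derivative D) (at (X k R y))"
    using F_differentiable unfolding differentiable_def by blast
  have lin: "linear D" using D has_derivative_linear by blast
  have coer: "a 0 * (norm h)\<^sup>2 \<le> D h \<bullet> h" for h
  proof (rule ccontr)
    let ?x = "X k R y"
    \<comment> \<open>Along the ray in direction \<open>h\<close>, strong monotonicity reads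
      \<open>\<phi> 0 \<le> \<phi> t\<close> for \<open>t > 0\<close>, which a negative slope at
      \<open>0\<close> would contradict.\<close>
    define \<phi> where "\<phi> t = F k R (?x + t *\<^sub>R h) \<bullet> h - a 0 * t * (norm h)\<^sup>2" for t
    have "((\<lambda>t. ?x + t *\<^sub>R h) has_derivative (\<lambda>t. t *\<^sub>R h)) (at 0)"
      by (auto intro!: derivative_eq_intros)
    then have "((\<lambda>t. F k R (?x + t *\<^sub>R h)) has_derivative (\<lambda>t. D (t *\<^sub>R h))) (at 0)"
      by (rule has_derivative_compose) (use D in simp)
    then have "(\<phi> has_derivative (\<lambda>t. D (t *\<^sub>R h) \<bullet> h - a 0 * t * (norm h)\<^sup>2)) (at 0)"
      unfolding \<phi>_def by (auto intro!: derivative_eq_intros)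
    then have "(\<phi> has_real_derivative (D h \<bullet> h - a 0 * (norm h)\<^sup>2)) (at 0)"
      unfolding has_field_derivative_def
      by (rule has_derivative_eq_rhs) (simp add: linear_cmul[OF lin] fun_eq_iff algebra_simps)
    moreover assume "\<not> a 0 * (norm h)\<^sup>2 \<le> D h \<bullet> h"
    ultimately obtain d where d: "d > 0" "\<And>t. 0 < t \<Longrightarrow> t < d \<Longrightarrow> \<phi> t < \<phi> 0"
      using DERIV_neg_dec_right[of \<phi> _ 0] by force
    define t where "t = d / 2"
    have t: "t > 0" "\<phi> t < \<phi> 0" using d by (auto simp: t_def)
    have "t * (a 0 * t * (norm h)\<^sup>2) \<le> t * ((F k R (?x + t *\<^sub>R h) - F k R ?x) \<bullet> h)"
      using F_strong_mono[of "?x + t *\<^sub>R h" ?x k R] t by (simp add: power_mult_distrib power2_eq_square mult_ac)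
    then have "\<phi> 0 \<le> \<phi> t" using t by (simp add: \<phi>_def inner_diff_left)
    then show False using t by simp
  qed
  have "inj D"
    unfolding linear_injective_0[OF lin]
  proof (intro allI impI)
    fix h assume "D h = 0"
    then show "h = 0" using coer[of h] a0_pos by (simp add: mult_le_0_iff)
  qed
  then obtain D' where D': "linear D'" "D' \<circ> D = id"
    using linear_injective_left_inverse[OF lin] by blast
  have "(X k R has_derivative D') (at y)"
    by (rule has_derivative_inverse_basic[where f = "F k R" and g = "X k R" and T = UNIV, OF D])
       (use D' continuous_X[of UNIV] F_X in \<open>auto simp: linear_conv_bounded_linear continuous_on_eq_continuous_at\<close>)
  moreover have "norm (D' h) \<le> norm h / a 0" for h
  proof (cases "D' h = 0")
    case False
    have "D (D' h) = h" using linear_inverse_left[OF lin D'(1)] D'(2) by (simp add: fun_eq_iff o_def)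
    then have "a 0 * (norm (D' h))\<^sup>2 \<le> norm h * norm (D' h)"
      using coer[of "D' h"] norm_cauchy_schwarz[of h "D' h"] by simp
    then have "a 0 * norm (D' h) \<le> norm h" using False by (simp add: power2_eq_square)
    then show ?thesis using a0_pos by (simp add: field_simps)
  qed (use a0_pos in simp)
  ultimately show ?thesis by (rule that)
qed

section \<open>Pointwise inequalities and their constants\<close>

definition weight_const :: "real \<Rightarrow> real" where
  "weight_const R = 4 * coercivity * (chi1 N \<alpha> a R)\<^sup>2"

text \<open>The summand \<open>1 / a 0\<close> comes from Young's inequality. The other one bounds
  the cost of passing from \<open>y\<close> to \<open>p\<close> after division by
  \<open>weight_const R\<close>, with \<open>chi1\<close> lowered to \<open>chi0\<close> so that
  \<open>R\<close> disappears.\<close>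

definition source_const :: real where
  "source_const = 1 / a 0 + 1 / (coercivity * (chi0 N \<alpha> a)\<^sup>2)"

lemma chi1_ge_chi0: "R \<ge> 0 \<Longrightarrow> chi0 N \<alpha> a \<le> chi1 N \<alpha> a R"
  by (simp add: chi1_def)

lemma weight_const_pos: "R \<ge> 0 \<Longrightarrow> weight_const R > 0"
  using chi1_ge_chi0[of R] chi0_pos coercivity_pos by (simp add: weight_const_def)

lemma source_const_pos: "source_const > 0"
  using chi0_pos coercivity_pos a0_pos by (simp add: source_const_def add_pos_pos)

text \<open>In the application \<open>p\<close>, \<open>q\<close>, \<open>\<zeta>\<close>,
  \<open>s\<close> are the gradients of \<open>u\<close> and \<open>\<Psi>\<close>, the field
  \<open>Z\<close>, and \<open>u\<close>. With \<open>P = X(y) . y\<close>, the terms in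
  \<open>s^2 \<zeta>\<close> and in \<open>q\<close> cost at most a quarter of \<open>P\<close>
  each. The remaining half controls the weighted square of \<open>y\<close>, and then that of
  \<open>p\<close>, since the weight is at most \<open>1\<close>.\<close>

lemma pointwise_energy_estimate:
  fixes p q \<zeta> :: "real^3" and s M :: real
  assumes k: "norm k = 1" and R: "R \<ge> 0" and \<zeta>: "norm \<zeta> \<le> M"
  defines "y \<equiv> p + s\<^sup>2 *\<^sub>R \<zeta>"
  shows "(1 + norm y) powr (- a_exp N \<alpha>) * (norm p)\<^sup>2 / weight_const R
    \<le> X k R y \<bullet> (p - q) + source_const * (M\<^sup>2 * s ^ 4 + (norm q)\<^sup>2)"
proof -
  define v where "v = X k R y"
  define K where "K = (1 + norm y) powr (- a_exp N \<alpha>)"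
  define P where "P = y \<bullet> v"
  let ?c = "chi1 N \<alpha> a R"
  have Fv: "F k R v = y" by (simp add: v_def F_X)
  have K: "0 \<le> K" "K \<le> 1"
    using a_exp_bounds by (auto simp: K_def powr_minus inverse_le_1_iff intro!: ge_one_powr_ge_zero)
  have coer: "K * (norm y)\<^sup>2 \<le> coercivity * ?c\<^sup>2 * P"
    using F_coercive[OF k R, of v] by (simp add: Fv K_def P_def)
  have P: "a 0 * (norm v)\<^sup>2 \<le> P"
    using F_inner_self[of k R v] g_ge_a0[of "norm v"] by (simp add: Fv P_def mult_right_mono)
  have M: "M \<ge> 0" using \<zeta> norm_ge_zero order_trans by blast
  have young: "x * norm v \<le> a 0 * (norm v)\<^sup>2 / 4 + x\<^sup>2 / a 0" for x
  proof -
    have "0 \<le> (a 0 * norm v / 2 - x)\<^sup>2 / a 0" using a0_pos by simp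
    also have "\<dots> = a 0 * (norm v)\<^sup>2 / 4 + x\<^sup>2 / a 0 - x * norm v"
      using a0_pos by (simp add: power2_eq_square field_simps)
    finally show ?thesis by simp
  qed
  have z1: "norm (s\<^sup>2 *\<^sub>R \<zeta>) \<le> s\<^sup>2 * M" using \<zeta> by (simp add: mult_left_mono)
  have "(s\<^sup>2 *\<^sub>R \<zeta>) \<bullet> v \<le> norm (s\<^sup>2 *\<^sub>R \<zeta>) * norm v" by (rule norm_cauchy_schwarz)
  also have "\<dots> \<le> (s\<^sup>2 * M) * norm v" using z1 by (rule mult_right_mono) simp
  also have "\<dots> \<le> a 0 * (norm v)\<^sup>2 / 4 + (s\<^sup>2 * M)\<^sup>2 / a 0" by (rule young)
  finally have t1: "(s\<^sup>2 *\<^sub>R \<zeta>) \<bullet> v \<le> a 0 * (norm v)\<^sup>2 / 4 + M\<^sup>2 * s ^ 4 / a 0"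
    by (simp add: power_mult_distrib mult.commute flip: power_mult)
  have t2: "q \<bullet> v \<le> a 0 * (norm v)\<^sup>2 / 4 + (norm q)\<^sup>2 / a 0"
    using norm_cauchy_schwarz[of q v] young[of "norm q"] by linarith
  have "v \<bullet> (p - q) = P - (s\<^sup>2 *\<^sub>R \<zeta>) \<bullet> v - q \<bullet> v"
    by (simp add: P_def y_def inner_diff_right inner_add_left inner_commute[of v])
  then have main: "P / 2 \<le> v \<bullet> (p - q) + (M\<^sup>2 * s ^ 4 + (norm q)\<^sup>2) / a 0"
    using t1 t2 P by (simp add: add_divide_distrib)
  have "norm p \<le> norm y + s\<^sup>2 * M"
    using norm_triangle_ineq4[of y "s\<^sup>2 *\<^sub>R \<zeta>"] z1 by (simp add: y_def)
  then have "(norm p)\<^sup>2 \<le> (norm y + s\<^sup>2 * M)\<^sup>2" by (intro power_mono) auto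
  also have "\<dots> \<le> 2 * (norm y)\<^sup>2 + 2 * (s\<^sup>2 * M)\<^sup>2"
    using sum_squares_bound[of "norm y" "s\<^sup>2 * M"] by (simp add: power2_sum)
  also have "(s\<^sup>2 * M)\<^sup>2 = M\<^sup>2 * s ^ 4"
    by (simp add: power_mult_distrib mult.commute flip: power_mult)
  finally have "K * (norm p)\<^sup>2 \<le> K * (2 * (norm y)\<^sup>2 + 2 * (M\<^sup>2 * s ^ 4))"
    using K by (intro mult_left_mono) auto
  also have "\<dots> \<le> 2 * (K * (norm y)\<^sup>2) + 2 * (M\<^sup>2 * s ^ 4)"
    using K mult_right_mono[OF K(2), of "M\<^sup>2 * s ^ 4"] by (simp add: algebra_simps)
  also have "\<dots> \<le> 2 * (coercivity * ?c\<^sup>2 * P) + 2 * (M\<^sup>2 * s ^ 4)" using coer by simp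
  \<comment> \<open>The \<open>4\<close> in \<open>weight_const\<close> is a \<open>2\<close> from
    squaring the triangle inequality times a \<open>2\<close> because only \<open>P / 2\<close> is
    left to dominate this term.\<close>
  finally have "K * (norm p)\<^sup>2 / weight_const R
      \<le> (2 * (coercivity * ?c\<^sup>2 * P) + 2 * (M\<^sup>2 * s ^ 4)) / weight_const R"
    using weight_const_pos[OF R] by (simp add: divide_right_mono)
  also have "\<dots> = P / 2 + M\<^sup>2 * s ^ 4 / (2 * (coercivity * ?c\<^sup>2))"
  proof -
    define W where "W = coercivity * ?c\<^sup>2"
    have "W > 0" using weight_const_pos[OF R] by (simp add: weight_const_def W_def)
    then have "(2 * (W * P) + 2 * (M\<^sup>2 * s ^ 4)) / (4 * W) = P / 2 + M\<^sup>2 * s ^ 4 / (2 * W)"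
      by (simp add: field_simps)
    then show ?thesis by (simp add: W_def weight_const_def mult.assoc)
  qed
  also have "M\<^sup>2 * s ^ 4 / (2 * (coercivity * ?c\<^sup>2)) \<le> M\<^sup>2 * s ^ 4 / (coercivity * (chi0 N \<alpha> a)\<^sup>2)"
  proof (rule divide_left_mono)
    have "(chi0 N \<alpha> a)\<^sup>2 \<le> ?c\<^sup>2" using chi1_ge_chi0[OF R] chi0_pos by (intro power_mono) auto
    then have "coercivity * (chi0 N \<alpha> a)\<^sup>2 \<le> coercivity * ?c\<^sup>2"
      using coercivity_pos by (intro mult_left_mono) auto
    then show "coercivity * (chi0 N \<alpha> a)\<^sup>2 \<le> 2 * (coercivity * ?c\<^sup>2)"
      using coercivity_pos by (smt (verit) mult_nonneg_nonneg zero_le_power2)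
    show "0 \<le> M\<^sup>2 * s ^ 4" by simp
    show "0 < 2 * (coercivity * ?c\<^sup>2) * (coercivity * (chi0 N \<alpha> a)\<^sup>2)"
      using chi1_ge_chi0[OF R] chi0_pos coercivity_pos by (intro mult_pos_pos zero_less_power) auto
  qed
  finally have "K * (norm p)\<^sup>2 / weight_const R \<le> v \<bullet> (p - q)
      + ((M\<^sup>2 * s ^ 4 + (norm q)\<^sup>2) / a 0 + M\<^sup>2 * s ^ 4 / (coercivity * (chi0 N \<alpha> a)\<^sup>2))"
    using main by linarith
  also have "(M\<^sup>2 * s ^ 4 + (norm q)\<^sup>2) / a 0 + M\<^sup>2 * s ^ 4 / (coercivity * (chi0 N \<alpha> a)\<^sup>2)
      \<le> source_const * (M\<^sup>2 * s ^ 4 + (norm q)\<^sup>2)"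
    using coercivity_pos by (simp add: source_const_def distrib_left distrib_right add_divide_distrib)
  finally show ?thesis by (simp add: K_def v_def)
qed

text \<open>Let \<open>r = s^2 M\<close>. If \<open>|p| \<le> 1 + r\<close>, the power is bounded by
  \<open>(1 + r)^2\<close> directly. Otherwise \<open>1 + |y| \<le> 2 |p|\<close>, so the weight is
  at least half of \<open>|p| powr (- a_exp N \<alpha>)\<close>.\<close>

lemma powr_le_weighted_square:
  fixes p \<zeta> :: "real^3" and s M :: real
  assumes \<zeta>: "norm \<zeta> \<le> M"
  defines "y \<equiv> p + s\<^sup>2 *\<^sub>R \<zeta>"
  shows "norm p powr (2 - a_exp N \<alpha>)
    \<le> 2 * ((1 + norm y) powr (- a_exp N \<alpha>) * (norm p)\<^sup>2) + 2 + 2 * (M\<^sup>2 * s ^ 4)"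
proof -
  let ?b = "a_exp N \<alpha>"
  have b: "0 < ?b" "?b < 1" by (rule a_exp_bounds)+
  have M: "M \<ge> 0" using \<zeta> norm_ge_zero order_trans by blast
  define r where "r = s\<^sup>2 * M"
  have r: "r \<ge> 0" using M by (simp add: r_def)
  have r2: "r\<^sup>2 = M\<^sup>2 * s ^ 4"
    by (simp add: r_def power_mult_distrib mult.commute flip: power_mult)
  have K: "0 \<le> (1 + norm y) powr (- ?b) * (norm p)\<^sup>2" by simp
  show ?thesis
  proof (cases "norm p \<le> 1 + r")
    case True
    have "norm p powr (2 - ?b) \<le> (1 + r) powr (2 - ?b)"
      using True b by (intro powr_mono2) auto
    also have "\<dots> \<le> (1 + r) powr 2" using r b by (intro powr_mono) auto
    also have "\<dots> = (1 + r)\<^sup>2" using r by simp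
    also have "\<dots> \<le> 2 + 2 * r\<^sup>2" using sum_squares_bound[of 1 r] by (simp add: power2_sum)
    finally show ?thesis using K r2 by linarith
  next
    case False
    then have p: "norm p > 1" "norm p > r" "norm p > 0" using r by auto
    have "norm (s\<^sup>2 *\<^sub>R \<zeta>) \<le> r" using \<zeta> by (simp add: r_def mult_left_mono)
    then have "1 + norm y \<le> 2 * norm p"
      using norm_triangle_ineq[of p "s\<^sup>2 *\<^sub>R \<zeta>"] False by (simp add: y_def)
    then have "(2 * norm p) powr (- ?b) \<le> (1 + norm y) powr (- ?b)"
      using b by (intro powr_mono2') (auto simp: add_pos_nonneg)
    moreover have "(2 * norm p) powr (- ?b) = 2 powr (- ?b) * norm p powr (- ?b)"
      by (simp add: powr_mult)
    moreover have "1 / 2 \<le> 2 powr (- ?b)"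
      using powr_mono[of "- 1" "- ?b" "2::real"] b by (simp add: powr_minus_divide)
    then have "1 / 2 * norm p powr (- ?b) \<le> 2 powr (- ?b) * norm p powr (- ?b)"
      by (intro mult_right_mono) auto
    ultimately have "norm p powr (- ?b) \<le> 2 * (1 + norm y) powr (- ?b)" by linarith
    then have "norm p powr (- ?b) * (norm p)\<^sup>2 \<le> 2 * (1 + norm y) powr (- ?b) * (norm p)\<^sup>2"
      by (intro mult_right_mono) auto
    moreover have "norm p powr (2 - ?b) = norm p powr (- ?b) * (norm p)\<^sup>2"
      using p by (simp add: powr_diff powr_minus field_simps)
    moreover have "0 \<le> M\<^sup>2 * s ^ 4" by simp
    ultimately show ?thesis unfolding mult.assoc by linarith
  qed
qed

text \<open>One summand for each comparison in \<open>source_le\<close>: \<open>1\<close> for the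
  terms with \<open>\<phi>\<close>, \<open>source_const\<close> for the fourth power of
  \<open>u\<close>, the last one for the gradient of \<open>\<Psi>\<close>.\<close>

definition data_const :: real where
  "data_const = 1 + source_const + source_const * chi0 N \<alpha> a powr (- (2 + 2 * a_exp N \<alpha>))"

lemma data_const_pos: "data_const > 0"
  using source_const_pos by (simp add: data_const_def add_pos_nonneg)

text \<open>The energy method yields \<open>chi1^2\<close> in front of the gradient of
  \<open>\<Psi>\<close>, the statement has the exponent \<open>2 (2 + a)\<close>. As
  \<open>chi1\<close> may be less than \<open>1\<close>, the surplus power
  \<open>chi1 powr (2 + 2 a)\<close> is bounded below by the same power of
  \<open>chi0\<close>.\<close>

lemma chi1_sq_le:
  assumes R: "R \<ge> 0"
  shows "(chi1 N \<alpha> a R)\<^sup>2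
    \<le> chi0 N \<alpha> a powr (- (2 + 2 * a_exp N \<alpha>)) * chi1 N \<alpha> a R powr (2 * (2 + a_exp N \<alpha>))"
proof -
  let ?b = "a_exp N \<alpha>" and ?c = "chi1 N \<alpha> a R" and ?d = "chi0 N \<alpha> a"
  have c: "?d > 0" "?d \<le> ?c" "?c > 0" using chi0_pos chi1_ge_chi0[OF R] by auto
  have "?d powr (2 + 2 * ?b) \<le> ?c powr (2 + 2 * ?b)"
    using c a_exp_bounds by (intro powr_mono2) auto
  then have "1 \<le> ?d powr (- (2 + 2 * ?b)) * ?c powr (2 + 2 * ?b)"
    unfolding powr_minus_divide using c by (simp add: le_divide_eq)
  then have "?c powr 2 * 1 \<le> ?c powr 2 * (?d powr (- (2 + 2 * ?b)) * ?c powr (2 + 2 * ?b))"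
    by (intro mult_left_mono) auto
  also have "\<dots> = ?d powr (- (2 + 2 * ?b)) * ?c powr (2 + (2 + 2 * ?b))"
    by (simp only: powr_add mult_ac)
  finally show ?thesis using c by (simp add: algebra_simps)
qed

end

section \<open>Integration by parts for fields vanishing on the boundary\<close>

text \<open>Locally the boundary lies in an isometric copy of a graph, that is, in the image of the
  plane under a differentiable map into space. Such an image is a null set, and negligibility can be
  tested locally.\<close>

lemma C1_boundary_imp_negligible_frontier:
  assumes U: "open U" "C1_boundary U"
  shows "negligible (frontier U)"
proof (subst locally_negligible_alt, intro ballI)
  fix p assume p: "p \<in> frontier U"
  obtain r Q \<gamma> where r: "r > 0" and Q: "orthogonal_transformation (Q :: real^3 \<Rightarrow> real^3)"
    and \<gamma>: "C1_function (\<gamma> :: real^2 \<Rightarrow> real)"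
    and eq: "U \<inter> ball p r = {x \<in> ball p r. Q x $ 3 > \<gamma> (vector [Q x $ 1, Q x $ 2])}"
    using U(2)[unfolded C1_boundary_def, rule_format, OF p] by blast
  \<comment> \<open>The height above the graph: inside the ball, \<open>U\<close> is the set
    \<open>d > 0\<close>. A boundary point cannot have \<open>d > 0\<close>, because
    \<open>U\<close> is open, nor \<open>d < 0\<close>, because that open set misses
    \<open>U\<close> and hence its closure.\<close>
  define d where "d x = Q x $ 3 - \<gamma> (vector [Q x $ 1, Q x $ 2])" for x
  define E where "E = (\<lambda>s::real^2. inv Q (vector [s $ 1, s $ 2, \<gamma> s]))"
  have linQ: "linear Q" using Q by (rule orthogonal_transformation_linear)
  have diff\<gamma>: "\<gamma> differentiable (at x)" for x
    using \<gamma> unfolding C1_function_def gderiv_def differentiable_def by blast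
  have cont\<gamma>: "continuous_on UNIV \<gamma>"
    by (intro differentiable_imp_continuous_on differentiable_at_imp_differentiable_on diff\<gamma>)
  have contQ: "continuous_on UNIV Q" using linQ by (rule linear_continuous_on_compose[OF continuous_on_id])
  have "continuous_on UNIV (\<lambda>x. vector [Q x $ 1, Q x $ 2] :: real^2)"
  proof -
    have "vector [Q x $ 1, Q x $ 2] = (\<chi> i::2. if i = 1 then Q x $ 1 else Q x $ 2)" for x
      by (simp add: vec_eq_iff forall_2)
    moreover have "continuous_on UNIV (\<lambda>x. if i = 1 then Q x $ 1 else Q x $ 2)" for i :: 2
      using contQ by (cases "i = 1") (auto intro: continuous_on_component)
    ultimately show ?thesis by (simp add: continuous_on_vec_lambda)
  qed
  then have cont: "continuous_on UNIV d"
    unfolding d_def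
    by (intro continuous_intros contQ continuous_on_compose2[OF cont\<gamma>]) auto
  have sub: "frontier U \<inter> ball p r \<subseteq> range E"
  proof
    fix x assume x: "x \<in> frontier U \<inter> ball p r"
    have "\<not> d x > 0"
    proof
      assume "d x > 0"
      then have "x \<in> U" using x eq by (auto simp: d_def)
      then show False using x U(1) by (simp add: frontier_def interior_open)
    qed
    moreover have "\<not> d x < 0"
    proof
      assume "d x < 0"
      have "open ({x. d x < 0} \<inter> ball p r)"
        using cont by (intro open_Int open_ball open_Collect_less continuous_on_const) auto
      moreover have "({x. d x < 0} \<inter> ball p r) \<inter> U = {}"
      proof (intro equals0I)
        fix x assume x: "x \<in> ({x. d x < 0} \<inter> ball p r) \<inter> U"
        then have "x \<in> U \<inter> ball p r" by blast
        then show False using x unfolding eq d_def by auto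
      qed
      ultimately have "({x. d x < 0} \<inter> ball p r) \<inter> closure U = {}"
        by (simp add: open_Int_closure_eq_empty)
      then show False using x \<open>d x < 0\<close> by (auto simp: frontier_def)
    qed
    ultimately have "d x = 0" by simp
    then have "Q x = vector [Q x $ 1, Q x $ 2, \<gamma> (vector [Q x $ 1, Q x $ 2])]"
      by (simp add: vec_eq_iff forall_3 d_def)
    then have "x = inv Q (vector [Q x $ 1, Q x $ 2, \<gamma> (vector [Q x $ 1, Q x $ 2])])"
      using orthogonal_transformation_inj[OF Q] by (metis inv_f_f)
    then show "x \<in> range E" unfolding E_def by (intro image_eqI[of _ _ "vector [Q x $ 1, Q x $ 2]"]) simp_all
  qed
  have linQ': "linear (inv Q)"
    using Q by (intro orthogonal_transformation_linear orthogonal_transformation_inv)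
  have "E differentiable_on UNIV"
    unfolding E_def
  proof (intro differentiable_at_imp_differentiable_on)
    fix s :: "real^2"
    have "(\<lambda>s::real^2. vector [s $ 1, s $ 2, \<gamma> s] :: real^3) differentiable (at s)"
    proof (subst differentiable_componentwise_within, intro ballI)
      fix i :: "real^3" assume "i \<in> Basis"
      then obtain j where j: "i = axis j 1" by (auto simp: Basis_vec_def)
      have "(\<lambda>s::real^2. s $ l) differentiable (at s)" for l
        by (intro bounded_linear_imp_differentiable bounded_linear_vec_nth)
      then show "(\<lambda>s::real^2. vector [s $ 1, s $ 2, \<gamma> s] \<bullet> i) differentiable (at s)"
        using diff\<gamma> exhaust_3[of j] by (auto simp: j inner_axis)
    qed
    then show "(\<lambda>s. inv Q (vector [s $ 1, s $ 2, \<gamma> s])) differentiable (at s)"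
      using differentiable_compose[OF linear_imp_differentiable[OF linQ']] by blast
  qed
  then have "negligible (range E)"
    by (rule negligible_differentiable_image_lowdim[rotated]) simp
  then have "negligible (frontier U \<inter> ball p r)" using sub negligible_subset by blast
  then show "\<exists>V. openin (top_of_set (frontier U)) V \<and> p \<in> V \<and> negligible V"
    using p r by (intro exI[of _ "frontier U \<inter> ball p r"]) (auto intro: openin_open_Int)
qed

text \<open>The mean value inequality works only on segments inside \<open>U\<close>, and
  \<open>U\<close> need not be convex. But \<open>f\<close> vanishes on the boundary, so
  \<open>|f x|\<close> is at most \<open>L\<close> times the distance from \<open>x\<close> to the
  complement. Two points whose segment leaves \<open>U\<close> are compared through a point of the
  segment outside \<open>U\<close>.\<close>

lemma zero_extension_lipschitz:
  fixes f :: "'a::euclidean_space \<Rightarrow> real"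
  assumes U: "open U" and cont: "continuous_on (closure U) f"
    and zero: "\<And>x. x \<in> frontier U \<Longrightarrow> f x = 0"
    and der: "\<And>x. x \<in> U \<Longrightarrow> (f has_derivative f' x) (at x)"
    and bound: "\<And>x h. x \<in> U \<Longrightarrow> \<bar>f' x h\<bar> \<le> L * norm h"
    and L: "L \<ge> 0"
  shows "\<bar>(if x \<in> U then f x else 0) - (if y \<in> U then f y else 0)\<bar> \<le> L * norm (x - y)"
proof -
  have seg: "\<bar>f x - f y\<bar> \<le> L * norm (x - y)" if "closed_segment x y \<subseteq> U" for x y
  proof -
    have "norm (f x - f y) \<le> L * norm (x - y)"
    proof (rule differentiable_bound[where S = "closed_segment x y" and f' = f'])
      fix z assume "z \<in> closed_segment x y"
      then have z: "z \<in> U" using that by blast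
      show "(f has_derivative f' z) (at z within closed_segment x y)"
        using der[OF z] by (rule has_derivative_at_withinI)
      show "onorm (f' z) \<le> L" using bound[OF z] by (auto intro!: onorm_le)
    qed auto
    then show ?thesis by simp
  qed
  have exit: "\<bar>f x\<bar> \<le> L * norm (x - y)" if x: "x \<in> U" and y: "y \<notin> U" for x y
  proof -
    \<comment> \<open>A nearest point of the complement, instead of an exit point towards
      \<open>y\<close>: the half-open segment from \<open>x\<close> to \<open>p\<close> then stays
      in \<open>U\<close> automatically, and \<open>p\<close> is no farther from \<open>x\<close>
      than \<open>y\<close> is.\<close>
    obtain p where p: "p \<in> - U" "\<And>z. z \<in> - U \<Longrightarrow> dist x p \<le> dist x z"
      using distance_attains_inf[of "- U" x] U y by (auto simp: closed_Compl)
    define q where "q t = x + t *\<^sub>R (p - x)" for t :: real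
    have q_in: "q t \<in> U" if "0 \<le> t" "t < 1" for t
    proof (rule ccontr)
      assume "q t \<notin> U"
      then have "dist x p \<le> dist x (q t)" using p(2) by simp
      also have "\<dots> = t * dist x p"
        using that by (simp add: q_def dist_norm norm_minus_commute)
      finally show False using that p(1) x by (auto simp: mult_le_cancel_right1)
    qed
    have q_lim: "(q \<longlongrightarrow> p) (at_left 1)"
      unfolding q_def by (auto intro!: tendsto_eq_intros)
    have ev: "eventually (\<lambda>t. q t \<in> U) (at_left (1::real))"
      using q_in by (auto intro!: exI[of _ 0] simp: eventually_at_left_field)
    have "p \<in> closure U"
      by (rule Lim_in_closed_set[OF closed_closure _ _ q_lim])
         (auto intro!: eventually_mono[OF ev] closure_subset[THEN subsetD])
    then have pf: "p \<in> frontier U" using p(1) U by (simp add: frontier_def interior_open)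
    have "((\<lambda>t. f (q t)) \<longlongrightarrow> f p) (at_left 1)"
      by (rule continuous_on_tendsto_compose[OF cont q_lim \<open>p \<in> closure U\<close>])
         (auto intro!: eventually_mono[OF ev] closure_subset[THEN subsetD])
    then have lim: "((\<lambda>t. \<bar>f x - f (q t)\<bar>) \<longlongrightarrow> \<bar>f x - f p\<bar>) (at_left 1)"
      by (intro tendsto_intros)
    have "\<bar>f x - f p\<bar> \<le> L * norm (x - p)"
    proof (rule tendsto_upperbound[OF lim])
      have "\<bar>f x - f (q t)\<bar> \<le> L * norm (x - p)" if t: "0 \<le> t" "t < 1" for t
      proof -
        have "closed_segment x (q t) \<subseteq> U"
        proof
          fix z assume "z \<in> closed_segment x (q t)"
          then obtain s where s: "0 \<le> s" "s \<le> 1" "z = (1 - s) *\<^sub>R x + s *\<^sub>R q t"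
            by (auto simp: in_segment)
          have "z = q (s * t)" by (simp add: s(3) q_def algebra_simps)
          moreover have "s * t < 1" using s t mult_left_le_one_le[of t s] by simp
          ultimately show "z \<in> U" using q_in[of "s * t"] s t by simp
        qed
        then have "\<bar>f x - f (q t)\<bar> \<le> L * norm (x - q t)" by (rule seg)
        also have "norm (x - q t) = t * norm (x - p)"
          using t by (simp add: q_def norm_minus_commute)
        also have "L * (t * norm (x - p)) \<le> L * norm (x - p)"
          using t L by (intro mult_left_mono) (auto simp: mult_left_le_one_le)
        finally show ?thesis .
      qed
      then show "eventually (\<lambda>t. \<bar>f x - f (q t)\<bar> \<le> L * norm (x - p)) (at_left 1)"
        by (auto simp: eventually_at_left_field intro!: exI[of _ 0])
    qed simp
    then have "\<bar>f x\<bar> \<le> L * norm (x - p)" using zero[OF pf] by simp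
    also have "\<dots> \<le> L * norm (x - y)"
      using p(2)[of y] y L by (intro mult_left_mono) (auto simp: dist_norm)
    finally show ?thesis .
  qed
  show ?thesis
  proof (cases "x \<in> U \<and> y \<in> U")
    case True
    show ?thesis
    proof (cases "closed_segment x y \<subseteq> U")
      case False
      \<comment> \<open>Since \<open>z\<close> lies on the segment, its distances to
        \<open>x\<close> and \<open>y\<close> add up to that of \<open>x\<close> and
        \<open>y\<close>, so no constant is lost.\<close>
      then obtain z where z: "z \<in> closed_segment x y" "z \<notin> U" by auto
      have "\<bar>f x - f y\<bar> \<le> \<bar>f x\<bar> + \<bar>f y\<bar>" by simp
      also have "\<dots> \<le> L * norm (x - z) + L * norm (y - z)"
        using True z exit by (intro add_mono) auto
      also have "\<dots> = L * norm (x - y)"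
        using z(1) by (simp add: between_mem_segment[symmetric] between dist_norm norm_minus_commute flip: distrib_left)
      finally show ?thesis using True by simp
    qed (use True seg in simp)
  next
    case False
    then show ?thesis
      using exit[of x y] exit[of y x] L by (cases "x \<in> U"; cases "y \<in> U") (auto simp: norm_minus_commute)
  qed
qed

lemma lborel_integral_translation:
  fixes G :: "'a::euclidean_space \<Rightarrow> real"
  assumes "integrable lborel G"
  shows "integrable lborel (\<lambda>x. G (x + c))" "(LINT x|lborel. G (x + c)) = (LINT x|lborel. G x)"
proof -
  have G: "G \<in> borel_measurable borel" using borel_measurable_integrable[OF assms] by simp
  have d: "distr lborel borel (\<lambda>x. x + c) = (lborel :: 'a measure)"
  proof -
    have "(\<lambda>x. x + c) = (+) c" by (simp add: fun_eq_iff add.commute)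
    then show ?thesis by (simp add: lborel_distr_plus)
  qed
  have "integrable (distr lborel borel (\<lambda>x. x + c)) G" using assms by (simp add: d)
  then show "integrable lborel (\<lambda>x. G (x + c))"
    using G by (subst (asm) integrable_distr_eq) simp_all
  have "(LINT x|distr lborel borel (\<lambda>x. x + c). G x) = (LINT x|lborel. G (x + c))"
    using G by (intro integral_distr) simp_all
  then show "(LINT x|lborel. G (x + c)) = (LINT x|lborel. G x)" by (simp add: d)
qed

text \<open>The difference quotients \<open>q n\<close> of the zero extension converge to
  \<open>f' x e\<close> inside \<open>U\<close> and to \<open>0\<close> off its closure. They are
  bounded by the Lipschitz constant times \<open>|e|\<close> and live in a common ball, so dominated
  convergence carries the vanishing integral to the limit.\<close>

lemma integral_derivative_eq_0:
  fixes f :: "'a::euclidean_space \<Rightarrow> real"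
  assumes U: "open U" "bounded U" "negligible (frontier U)" and cont: "continuous_on (closure U) f"
    and zero: "\<And>x. x \<in> frontier U \<Longrightarrow> f x = 0"
    and der: "\<And>x. x \<in> U \<Longrightarrow> (f has_derivative f' x) (at x)"
    and bound: "\<And>x h. x \<in> U \<Longrightarrow> \<bar>f' x h\<bar> \<le> L * norm h" and L: "L \<ge> 0"
  shows "set_integrable lborel U (\<lambda>x. f' x e)" "(LINT x:U|lborel. f' x e) = 0"
proof -
  define G where "G x = (if x \<in> U then f x else 0)" for x
  define c where "c n = e /\<^sub>R real (Suc n)" for n
  define q where "q n x = real (Suc n) * (G (x + c n) - G x)" for n x
  have lip: "\<bar>G x - G y\<bar> \<le> L * norm (x - y)" for x y
    unfolding G_def by (rule zero_extension_lipschitz[OF U(1) cont zero der bound L])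
  have contG: "continuous_on UNIV G"
    by (rule lipschitz_on_continuous_on[where L = L])
       (use lip L in \<open>auto intro!: lipschitz_onI simp: dist_norm\<close>)
  then have measG: "G \<in> borel_measurable borel" by (rule borel_measurable_continuous_onI)
  have "compact (closure U)" using U(2) by (simp add: compact_closure)
  then have "compact (f ` closure U)" using cont compact_continuous_image by blast
  then obtain M where M: "\<And>x. x \<in> closure U \<Longrightarrow> \<bar>f x\<bar> \<le> M"
    using compact_imp_bounded[of "f ` closure U"] by (auto simp: bounded_iff)
  have finU: "emeasure lborel S < \<infinity>" if "bounded S" for S :: "'a set"
    using that by (rule emeasure_bounded_finite)
  have "integrable lborel (\<lambda>x. M * indicator U x)"
    using U finU[of U] by (intro integrable_mult_right integrable_real_indicator) auto
  then have intG: "integrable lborel G"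
  proof (rule Bochner_Integration.integrable_bound)
    have "norm (G x) \<le> norm (M * indicator U x)" for x
      using M[of x] closure_subset[of U] by (cases "x \<in> U") (auto simp: G_def)
    then show "AE x in lborel. norm (G x) \<le> norm (M * indicator U x)" by simp
  qed (use measG in simp)
  have q0: "(LINT x|lborel. q n x) = 0" for n
    using lborel_integral_translation[OF intG, of "c n"] intG by (simp add: q_def)
  have c0: "c \<longlonglongrightarrow> 0"
  proof -
    have "(\<lambda>n. inverse (real (Suc n)) *\<^sub>R e) \<longlonglongrightarrow> 0 *\<^sub>R e"
      by (intro tendsto_intros LIMSEQ_inverse_real_of_nat)
    then show ?thesis by (simp add: c_def[abs_def])
  qed
  have lim_in: "(\<lambda>n. q n x) \<longlonglongrightarrow> f' x e" if x: "x \<in> U" for x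
  proof -
    have "((\<lambda>t. x + t *\<^sub>R e) has_derivative (\<lambda>t. t *\<^sub>R e)) (at 0)"
      by (auto intro!: derivative_eq_intros)
    then have "((\<lambda>t. f (x + t *\<^sub>R e)) has_derivative (\<lambda>t. f' x (t *\<^sub>R e))) (at 0)"
      by (rule has_derivative_compose) (use der[OF x] in simp)
    then have "((\<lambda>t. f (x + t *\<^sub>R e)) has_real_derivative f' x e) (at 0)"
      unfolding has_field_derivative_def
      by (rule has_derivative_eq_rhs)
         (simp add: fun_eq_iff linear_cmul[OF has_derivative_linear[OF der[OF x]]])
    then have "((\<lambda>t. (f (x + t *\<^sub>R e) - f x) / t) \<longlongrightarrow> f' x e) (at 0)"
      by (simp add: has_field_derivative_iff)
    moreover have "filterlim (\<lambda>n. inverse (real (Suc n))) (at 0) sequentially"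
      using LIMSEQ_inverse_real_of_nat by (auto simp: filterlim_at)
    ultimately have lim: "(\<lambda>n. (f (x + inverse (real (Suc n)) *\<^sub>R e) - f x) / inverse (real (Suc n)))
        \<longlonglongrightarrow> f' x e"
      by (rule filterlim_compose)
    have "(\<lambda>n. x + c n) \<longlonglongrightarrow> x" using tendsto_add[OF tendsto_const c0, of x] by simp
    then have "eventually (\<lambda>n. x + c n \<in> U) sequentially"
      using U(1) x by (rule topological_tendstoD)
    then have "eventually (\<lambda>n. (f (x + inverse (real (Suc n)) *\<^sub>R e) - f x) / inverse (real (Suc n))
        = q n x) sequentially"
      by eventually_elim (use x in \<open>simp add: q_def G_def c_def field_simps\<close>)
    with lim show ?thesis by (rule Lim_transform_eventually)
  qed
  have lim_out: "(\<lambda>n. q n x) \<longlonglongrightarrow> 0" if x: "x \<notin> closure U" for x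
  proof -
    have "(\<lambda>n. x + c n) \<longlonglongrightarrow> x" using tendsto_add[OF tendsto_const c0, of x] by simp
    then have "eventually (\<lambda>n. x + c n \<in> - closure U) sequentially"
      using x by (intro topological_tendstoD) auto
    then have "eventually (\<lambda>n. q n x = 0) sequentially"
      by eventually_elim (use x closure_subset[of U] in \<open>auto simp: q_def G_def\<close>)
    then show ?thesis by (rule tendsto_eventually)
  qed
  have measq: "q n \<in> borel_measurable borel" for n
    unfolding q_def using measG by measurable
  \<comment> \<open>No continuity of \<open>f'\<close> is assumed; measurability is inherited from
    the quotients as a pointwise limit.\<close>
  have "(\<lambda>x. indicator U x * f' x e) \<in> borel_measurable borel"
  proof (rule borel_measurable_LIMSEQ_real)
    fix x :: 'a
    show "(\<lambda>n. indicator U x * q n x) \<longlonglongrightarrow> indicator U x * f' x e"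
      using lim_in[of x] by (cases "x \<in> U") auto
  next
    fix n
    have "U \<in> sets borel" using U(1) by simp
    then show "(\<lambda>x. indicator U x * q n x) \<in> borel_measurable borel" using measq by measurable
  qed
  then have measf: "(\<lambda>x. indicator U x * f' x e) \<in> borel_measurable lborel" by simp
  obtain B where B: "\<And>x. x \<in> U \<Longrightarrow> norm x \<le> B" using U(2) unfolding bounded_iff by blast
  \<comment> \<open>Every step \<open>c n\<close> is at most \<open>|e|\<close> long, so enlarging
    the ball around \<open>U\<close> by \<open>|e|\<close> catches the supports of all
    quotients.\<close>
  define w where "w x = L * norm e * indicator (cball 0 (B + norm e)) x" for x :: 'a
  have intw: "integrable lborel w"
    unfolding w_def using finU[OF bounded_cball[of 0 "B + norm e"]]
    by (intro integrable_mult_right integrable_real_indicator) auto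
  have qw: "norm (q n x) \<le> w x" for n x
  proof (cases "x \<in> cball 0 (B + norm e)")
    case True
    have "\<bar>q n x\<bar> \<le> real (Suc n) * (L * norm (c n))"
      unfolding q_def abs_mult using lip[of "x + c n" x] by (intro mult_mono) auto
    also have "\<dots> = w x" using True by (simp add: w_def c_def del: of_nat_Suc)
    finally show ?thesis by simp
  next
    case False
    have cn: "norm (c n) \<le> norm e"
      by (simp add: c_def divide_inverse_commute[symmetric] divide_le_eq mult_le_cancel_left1)
    have "x \<notin> U" using False B[of x] norm_ge_zero[of e] by auto
    moreover have "x + c n \<notin> U"
      using False B[of "x + c n"] cn norm_triangle_ineq4[of "x + c n" "c n"] by auto
    ultimately show ?thesis using False by (simp add: q_def G_def w_def)
  qed
  have "frontier U \<in> null_sets lborel"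
    using U(3) negligible_iff_null_sets null_sets_completion_iff[of "frontier U" lborel] by auto
  then have "AE x in lborel. x \<notin> frontier U" by (rule AE_not_in)
  then have ae: "AE x in lborel. (\<lambda>n. q n x) \<longlonglongrightarrow> indicator U x * f' x e"
  proof eventually_elim
    case (elim x)
    then show ?case using lim_in[of x] lim_out[of x] U(1)
      by (cases "x \<in> U") (auto simp: frontier_def interior_open)
  qed
  have dc: "integrable lborel (\<lambda>x. indicator U x * f' x e)"
      "(\<lambda>n. LINT x|lborel. q n x) \<longlonglongrightarrow> (LINT x|lborel. indicator U x * f' x e)"
    using measq qw
    by (auto intro!: integrable_dominated_convergence[OF measf _ intw ae]
        integral_dominated_convergence[OF measf _ intw ae])
  show "set_integrable lborel U (\<lambda>x. f' x e)" using dc(1) by (simp add: set_integrable_def)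
  show "(LINT x:U|lborel. f' x e) = 0"
    using LIMSEQ_unique[OF dc(2)] by (simp add: q0 set_lebesgue_integral_def)
qed

text \<open>The previous lemma applied to \<open>w\<close> times the \<open>i\<close>-th component
  of \<open>V\<close>, in direction \<open>axis i 1\<close>, and summed over \<open>i\<close>. These
  products vanish on the boundary because \<open>w\<close> does, whatever the values of
  \<open>V\<close> there.\<close>

lemma integral_divergence_eq_0:
  fixes w :: "real^'n \<Rightarrow> real" and V :: "real^'n \<Rightarrow> real^'n"
  assumes U: "open U" "bounded U" "negligible (frontier U)"
    and cw: "continuous_on (closure U) w" and zero: "\<And>x. x \<in> frontier U \<Longrightarrow> w x = 0"
    and cV: "continuous_on (closure U) V"
    and dw: "\<And>x. x \<in> U \<Longrightarrow> GDERIV w x :> Dw x"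
    and dV: "\<And>x. x \<in> U \<Longrightarrow> (V has_derivative DV x) (at x)"
    and bw: "\<And>x. x \<in> U \<Longrightarrow> \<bar>w x\<bar> \<le> B1" and bV: "\<And>x. x \<in> U \<Longrightarrow> norm (V x) \<le> B2"
    and bDw: "\<And>x. x \<in> U \<Longrightarrow> norm (Dw x) \<le> B3"
    and bDV: "\<And>x h. x \<in> U \<Longrightarrow> norm (DV x h) \<le> B4 * norm h"
    and nonneg: "B1 \<ge> 0" "B2 \<ge> 0" "B3 \<ge> 0" "B4 \<ge> 0"
  shows "set_integrable lborel U (\<lambda>x. w x * divergence V x + V x \<bullet> Dw x)"
    and "(LINT x:U|lborel. w x * divergence V x + V x \<bullet> Dw x) = 0"
proof -
  define f' where "f' i x h = (h \<bullet> Dw x) * V x $ i + w x * DV x h $ i" for i x h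
  have f: "set_integrable lborel U (\<lambda>x. f' i x e)" "(LINT x:U|lborel. f' i x e) = 0" for i e
  proof -
    have c: "continuous_on (closure U) (\<lambda>x. w x * V x $ i)"
      by (intro continuous_intros cw cV)
    have d: "((\<lambda>x. w x * V x $ i) has_derivative f' i x) (at x)" if "x \<in> U" for x
    proof -
      have "((\<lambda>x. V x $ i) has_derivative (\<lambda>h. DV x h $ i)) (at x)"
        using dV[OF that] by (rule bounded_linear.has_derivative[OF bounded_linear_vec_nth])
      from has_derivative_mult[OF dw[OF that, unfolded gderiv_def] this] show ?thesis
        by (rule has_derivative_eq_rhs) (simp add: f'_def fun_eq_iff)
    qed
    have b: "\<bar>f' i x h\<bar> \<le> (B3 * B2 + B1 * B4) * norm h" if x: "x \<in> U" for x h
    proof -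
      have "\<bar>h \<bullet> Dw x\<bar> \<le> norm h * B3"
        using Cauchy_Schwarz_ineq2[of h "Dw x"] mult_left_mono[OF bDw[OF x], of "norm h"] by simp
      moreover have "\<bar>V x $ i\<bar> \<le> B2" using component_le_norm_cart[of "V x" i] bV[OF x] by simp
      ultimately have 1: "\<bar>(h \<bullet> Dw x) * V x $ i\<bar> \<le> norm h * B3 * B2"
        unfolding abs_mult using nonneg by (intro mult_mono) auto
      have "\<bar>DV x h $ i\<bar> \<le> B4 * norm h" using component_le_norm_cart[of "DV x h" i] bDV[OF x, of h] by simp
      then have 2: "\<bar>w x * DV x h $ i\<bar> \<le> B1 * (B4 * norm h)"
        unfolding abs_mult using nonneg bw[OF x] by (intro mult_mono) auto
      show ?thesis using 1 2 by (simp add: f'_def algebra_simps)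
    qed
    have n: "0 \<le> B3 * B2 + B1 * B4" using nonneg by simp
    have z: "w x * V x $ i = 0" if "x \<in> frontier U" for x using zero[OF that] by simp
    note zero_int = integral_derivative_eq_0[OF U c z d b n]
    show "set_integrable lborel U (\<lambda>x. f' i x e)" using zero_int(1) by simp
    show "(LINT x:U|lborel. f' i x e) = 0" using zero_int(2) by simp
  qed
  have eq: "w x * divergence V x + V x \<bullet> Dw x = (\<Sum>i\<in>UNIV. f' i x (axis i 1))" if "x \<in> U" for x
  proof -
    have "frechet_derivative V (at x) = DV x" using frechet_derivative_at[OF dV[OF that]] by simp
    moreover have "f' i x (axis i 1) = Dw x $ i * V x $ i + w x * DV x (axis i 1) $ i" for i
      by (simp add: f'_def inner_axis')
    ultimately show ?thesis
      by (simp add: divergence_def sum.distrib sum_distrib_left inner_vec_def mult.commute)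
  qed
  have eq': "indicator U x *\<^sub>R (w x * divergence V x + V x \<bullet> Dw x)
      = (\<Sum>i\<in>UNIV. indicator U x *\<^sub>R f' i x (axis i 1))" for x
    using eq[of x] by (cases "x \<in> U") (auto simp: sum_distrib_left)
  show "set_integrable lborel U (\<lambda>x. w x * divergence V x + V x \<bullet> Dw x)"
    unfolding set_integrable_def eq'
    using f(1) by (intro Bochner_Integration.integrable_sum) (simp add: set_integrable_def)
  show "(LINT x:U|lborel. w x * divergence V x + V x \<bullet> Dw x) = 0"
    unfolding set_lebesgue_integral_def eq'
    using f by (subst Bochner_Integration.integral_sum) (simp_all add: set_integrable_def set_lebesgue_integral_def)
qed

section \<open>Integration over cylinders\<close>

lemma set_integral_nonneg:
  fixes f :: "'a::euclidean_space \<Rightarrow> real"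
  assumes "\<And>z. 0 \<le> f z"
  shows "0 \<le> (LINT z:S|lborel. f z)"
  unfolding set_lebesgue_integral_def using assms by (intro integral_nonneg_AE) auto

lemma cylinder_measurable:
  fixes h :: "'a::euclidean_space \<Rightarrow> real \<Rightarrow> real"
  assumes U: "U \<in> sets borel" and I: "I \<in> sets borel"
    and cont: "continuous_on (U \<times> I) (\<lambda>z. h (fst z) (snd z))"
  shows "(\<lambda>z. indicator (U \<times> I) z * h (fst z) (snd z)) \<in> borel_measurable borel"
proof -
  have "U \<times> I \<in> sets borel" using U I by (metis borel_Times)
  from borel_measurable_continuous_on_indicator[OF this cont] show ?thesis by simp
qed

lemma set_integrable_bounded:
  fixes h :: "'a::euclidean_space \<Rightarrow> real"
  assumes S: "S \<in> sets borel" "bounded S" and cont: "continuous_on S h"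
    and bound: "\<And>x. x \<in> S \<Longrightarrow> \<bar>h x\<bar> \<le> B"
  shows "set_integrable lborel S h"
  unfolding set_integrable_def
proof (rule Bochner_Integration.integrable_bound)
  show "integrable lborel (\<lambda>x. B * indicator S x)"
    using S emeasure_bounded_finite[OF S(2)] by (intro integrable_mult_right integrable_real_indicator) auto
  show "(\<lambda>x. indicator S x *\<^sub>R h x) \<in> borel_measurable lborel"
    using borel_measurable_continuous_on_indicator[OF S(1) cont] by simp
  have "norm (indicator S x *\<^sub>R h x) \<le> norm (B * indicator S x)" for x
    using bound[of x] by (cases "x \<in> S") auto
  then show "AE x in lborel. norm (indicator S x *\<^sub>R h x) \<le> norm (B * indicator S x)" by simp
qed

lemma cylinder_Fubini:
  fixes h :: "'a::euclidean_space \<Rightarrow> real \<Rightarrow> real"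
  assumes "set_integrable lborel (U \<times> I) (\<lambda>z. h (fst z) (snd z))"
  shows "(LINT z:U\<times>I|lborel. h (fst z) (snd z)) = (LINT t:I|lborel. (LINT x:U|lborel. h x t))"
    and "(LINT z:U\<times>I|lborel. h (fst z) (snd z)) = (LINT x:U|lborel. (LINT t:I|lborel. h x t))"
    and "set_integrable lborel I (\<lambda>t. LINT x:U|lborel. h x t)"
    and "set_integrable lborel U (\<lambda>x. LINT t:I|lborel. h x t)"
proof -
  let ?f = "\<lambda>x t. indicator (U \<times> I) (x, t) *\<^sub>R h x t"
  have int: "integrable (lborel \<Otimes>\<^sub>M lborel) (case_prod ?f)"
    using assms by (simp add: set_integrable_def lborel_prod case_prod_unfold)
  have eq: "(LINT z:U\<times>I|lborel. h (fst z) (snd z)) = (LINT z|(lborel \<Otimes>\<^sub>M lborel). case_prod ?f z)"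
    by (simp add: set_lebesgue_integral_def lborel_prod case_prod_unfold)
  have t: "(LINT x|lborel. ?f x t) = indicator I t * (LINT x:U|lborel. h x t)" for t
    by (cases "t \<in> I") (simp_all add: set_lebesgue_integral_def indicator_times)
  have x: "(LINT t|lborel. ?f x t) = indicator U x * (LINT t:I|lborel. h x t)" for x
    by (cases "x \<in> U") (simp_all add: set_lebesgue_integral_def indicator_times)
  show "(LINT z:U\<times>I|lborel. h (fst z) (snd z)) = (LINT t:I|lborel. (LINT x:U|lborel. h x t))"
    unfolding eq lborel_pair.integral_snd[OF int, symmetric] t
    by (simp add: set_lebesgue_integral_def)
  show "(LINT z:U\<times>I|lborel. h (fst z) (snd z)) = (LINT x:U|lborel. (LINT t:I|lborel. h x t))"
    unfolding eq lborel_pair.integral_fst[OF int, symmetric] x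
    by (simp add: set_lebesgue_integral_def)
  show "set_integrable lborel I (\<lambda>t. LINT x:U|lborel. h x t)"
    using lborel_pair.integrable_snd[OF int] unfolding t by (simp add: set_integrable_def)
  show "set_integrable lborel U (\<lambda>x. LINT t:I|lborel. h x t)"
    using lborel_pair.integrable_fst[OF int] unfolding x by (simp add: set_integrable_def)
qed

text \<open>Tonelli's theorem in place of Fubini's, because the finiteness of the gradient integrals
  is a conclusion of the theorem.\<close>

lemma cylinder_nn_integral:
  fixes h :: "'a::euclidean_space \<Rightarrow> real \<Rightarrow> real"
  assumes U: "U \<in> sets borel" and I: "I \<in> sets borel"
    and cont: "continuous_on (U \<times> I) (\<lambda>z. h (fst z) (snd z))"
  shows "(\<integral>\<^sup>+t\<in>I. (\<integral>\<^sup>+x\<in>U. ennreal (h x t) \<partial>lborel) \<partial>lborel)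
    = (\<integral>\<^sup>+z\<in>U \<times> I. ennreal (h (fst z) (snd z)) \<partial>lborel)"
proof -
  let ?f = "\<lambda>z. ennreal (indicator (U \<times> I) z * h (fst z) (snd z))"
  have meas: "?f \<in> borel_measurable (lborel \<Otimes>\<^sub>M lborel)"
    using cylinder_measurable[OF assms] by (simp add: lborel_prod)
  have t: "(\<integral>\<^sup>+x. ?f (x, t) \<partial>lborel) = (\<integral>\<^sup>+x\<in>U. ennreal (h x t) \<partial>lborel) * indicator I t" for t
    by (cases "t \<in> I") (auto simp: indicator_times intro!: nn_integral_cong split: split_indicator)
  have "(\<integral>\<^sup>+z\<in>U \<times> I. ennreal (h (fst z) (snd z)) \<partial>lborel) = (\<integral>\<^sup>+z. ?f z \<partial>(lborel \<Otimes>\<^sub>M lborel))"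
    unfolding lborel_prod by (intro nn_integral_cong) (auto split: split_indicator)
  also have "\<dots> = (\<integral>\<^sup>+t. (\<integral>\<^sup>+x. ?f (x, t) \<partial>lborel) \<partial>lborel)"
    using lborel_pair.nn_integral_snd[OF meas] by simp
  finally show ?thesis unfolding t by simp
qed

lemma nn_integral_eq_LINT:
  fixes h :: "'a::euclidean_space \<Rightarrow> real"
  assumes "set_integrable lborel S h" and "\<And>x. x \<in> S \<Longrightarrow> 0 \<le> h x"
  shows "(\<integral>\<^sup>+x\<in>S. ennreal (h x) \<partial>lborel) = ennreal (LINT x:S|lborel. h x)"
proof -
  have "(\<integral>\<^sup>+x\<in>S. ennreal (h x) \<partial>lborel) = (\<integral>\<^sup>+x. ennreal (indicator S x *\<^sub>R h x) \<partial>lborel)"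
    by (intro nn_integral_cong) (auto split: split_indicator)
  also have "\<dots> = ennreal (LINT x|lborel. indicator S x *\<^sub>R h x)"
    using assms by (intro nn_integral_eq_integral) (auto simp: set_integrable_def split: split_indicator)
  finally show ?thesis by (simp add: set_lebesgue_integral_def)
qed

lemma L_norm_2_sq: "(L_norm 2 S f)\<^sup>2 = (LINT z:S|lborel. (f z)\<^sup>2)"
proof -
  have "\<bar>f z\<bar> powr 2 = (f z)\<^sup>2" for z by (cases "f z = 0") simp_all
  moreover have "0 \<le> (LINT z:S|lborel. (f z)\<^sup>2)"
    by (rule set_integral_nonneg) simp
  ultimately show ?thesis by (simp add: L_norm_def powr_half_sqrt)
qed

lemma L_norm_4_pow4: "L_norm 4 S f ^ 4 = (LINT z:S|lborel. (f z) ^ 4)"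
proof -
  have "\<bar>f z\<bar> powr 4 = (f z) ^ 4" for z by (cases "f z = 0") simp_all
  then have "L_norm 4 S f = (LINT z:S|lborel. (f z) ^ 4) powr (1 / 4)" by (simp add: L_norm_def)
  moreover have "0 \<le> (LINT z:S|lborel. (f z) ^ 4)"
    by (rule set_integral_nonneg) simp
  ultimately show ?thesis by (cases "(LINT z:S|lborel. (f z) ^ 4) = 0") (simp_all flip: powr_realpow add: powr_powr)
qed

text \<open>The integrand may blow up as \<open>t\<close> tends to \<open>0\<close>, so it is
  integrated over slabs growing to the cylinder, by monotone convergence. The bounds
  \<open>b n\<close> are not assumed monotone; only their limit enters.\<close>

lemma nn_integral_cylinder_exhaustion:
  fixes h :: "'a::euclidean_space \<times> real \<Rightarrow> real"
  assumes U: "U \<in> sets borel" and T: "T > 0"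
    and cont: "continuous_on (U \<times> {0<..T}) h"
    and bound: "\<And>n. (\<integral>\<^sup>+z\<in>U \<times> {T / real (n + 2)..T}. ennreal (h z) \<partial>lborel) \<le> ennreal (b n)"
    and lim: "b \<longlonglongrightarrow> c"
  shows "(\<integral>\<^sup>+z\<in>U \<times> {0<..<T}. ennreal (h z) \<partial>lborel) \<le> ennreal c"
proof -
  \<comment> \<open>Adding \<open>2\<close> keeps the lower end defined, positive and strictly below
    \<open>T\<close> already for \<open>n = 0\<close>.\<close>
  define S where "S n = U \<times> {T / real (n + 2)..T}" for n
  have S_sub: "S n \<subseteq> U \<times> {0<..T}" for n
  proof -
    have "0 < T / real (n + 2)" using T by simp
    then show ?thesis unfolding S_def by force
  qed
  have S_borel: "S n \<in> sets borel" for n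
    using U by (auto simp: S_def intro!: borel_Times)
  have S_mono: "S n \<subseteq> S m" if "n \<le> m" for n m
  proof -
    have "T / real (m + 2) \<le> T / real (n + 2)" using T that by (intro divide_left_mono) auto
    then show ?thesis unfolding S_def by force
  qed
  have S_cover: "\<exists>n. z \<in> S n" if z: "z \<in> U \<times> {0<..<T}" for z
  proof -
    obtain n where "T / snd z < real n" using reals_Archimedean2 by blast
    then have "T < snd z * real n" using z by (auto simp: field_simps)
    also have "\<dots> \<le> snd z * real (n + 2)" using z by (intro mult_left_mono) auto
    finally have "z \<in> S n" using z by (auto simp: S_def field_simps)
    then show ?thesis ..
  qed
  have meas: "(\<lambda>z. ennreal (h z) * indicator (S n) z) \<in> borel_measurable lborel" for n
  proof -
    have "(\<lambda>z. indicator (S n) z *\<^sub>R h z) \<in> borel_measurable borel"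
      by (intro borel_measurable_continuous_on_indicator S_borel continuous_on_subset[OF cont S_sub])
    then have "(\<lambda>z. ennreal (indicator (S n) z *\<^sub>R h z)) \<in> borel_measurable lborel" by simp
    also have "(\<lambda>z. ennreal (indicator (S n) z *\<^sub>R h z)) = (\<lambda>z. ennreal (h z) * indicator (S n) z)"
      by (auto simp: fun_eq_iff split: split_indicator)
    finally show ?thesis .
  qed
  have inc: "incseq (\<lambda>n z. ennreal (h z) * indicator (S n) z)"
    using S_mono[OF le_SucI[OF order_refl]]
    by (intro incseq_SucI le_funI mult_left_mono) (auto simp: indicator_def subset_iff)
  have "(\<integral>\<^sup>+z\<in>U \<times> {0<..<T}. ennreal (h z) \<partial>lborel)
      \<le> (\<integral>\<^sup>+z. (SUP n. ennreal (h z) * indicator (S n) z) \<partial>lborel)"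
  proof (intro nn_integral_mono)
    fix z :: "'a \<times> real"
    show "ennreal (h z) * indicator (U \<times> {0<..<T}) z \<le> (SUP n. ennreal (h z) * indicator (S n) z)"
    proof (cases "z \<in> U \<times> {0<..<T}")
      case True
      then obtain n where "z \<in> S n" using S_cover by blast
      then show ?thesis using True by (intro SUP_upper2[of n]) auto
    qed simp
  qed
  also have "\<dots> = (SUP n. \<integral>\<^sup>+z\<in>S n. ennreal (h z) \<partial>lborel)"
    using inc meas by (rule nn_integral_monotone_convergence_SUP)
  also have "\<dots> \<le> ennreal c"
  proof (rule SUP_least)
    fix n
    show "(\<integral>\<^sup>+z\<in>S n. ennreal (h z) \<partial>lborel) \<le> ennreal c"
    \<comment> \<open>The slab with index \<open>n\<close> lies in every later one, so its integral
      is below \<open>b m\<close> for all \<open>m \<ge> n\<close> and hence below the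
      limit.\<close>
    proof (rule LIMSEQ_le_const[OF tendsto_ennrealI[OF lim]], intro exI allI impI)
      fix m assume "n \<le> m"
      then have "(\<integral>\<^sup>+z\<in>S n. ennreal (h z) \<partial>lborel) \<le> (\<integral>\<^sup>+z\<in>S m. ennreal (h z) \<partial>lborel)"
        using S_mono[of n m] by (intro nn_integral_mono mult_left_mono) (auto simp: indicator_def subset_iff)
      also have "\<dots> \<le> ennreal (b m)" using bound[of m] by (simp add: S_def)
      finally show "(\<integral>\<^sup>+z\<in>S n. ennreal (h z) \<partial>lborel) \<le> ennreal (b m)" .
    qed
  qed
  finally show ?thesis .
qed

section \<open>Bounds and continuity on slabs and slices\<close>

lemma compact_slab_bound:
  fixes f :: "'a::heine_borel \<Rightarrow> real \<Rightarrow> 'b::real_normed_vector"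
  assumes U: "bounded U" and cont: "continuous_on (closure U \<times> I) (\<lambda>z. f (fst z) (snd z))"
    and I: "{\<tau>..T} \<subseteq> I"
  shows "\<exists>B\<ge>0. \<forall>x\<in>closure U. \<forall>t\<in>{\<tau>..T}. norm (f x t) \<le> B"
proof -
  have "compact (closure U \<times> {\<tau>..T})" using U by (intro compact_Times) (auto simp: compact_closure)
  moreover have "continuous_on (closure U \<times> {\<tau>..T}) (\<lambda>z. f (fst z) (snd z))"
    using I by (intro continuous_on_subset[OF cont]) auto
  ultimately have "bounded ((\<lambda>z. f (fst z) (snd z)) ` (closure U \<times> {\<tau>..T}))"
    by (intro compact_imp_bounded compact_continuous_image)
  then obtain B where B: "\<And>z. z \<in> closure U \<times> {\<tau>..T} \<Longrightarrow> norm (f (fst z) (snd z)) \<le> B"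
    unfolding bounded_iff by blast
  have "norm (f x t) \<le> \<bar>B\<bar>" if "x \<in> closure U" "t \<in> {\<tau>..T}" for x t
    using B[of "(x, t)"] that by simp
  then show ?thesis by (intro exI[of _ "\<bar>B\<bar>"]) simp
qed

lemma continuous_on_time_slice:
  assumes "continuous_on (S \<times> I) (\<lambda>z. f (fst z) (snd z))" "t \<in> I"
  shows "continuous_on S (\<lambda>x. f x t)"
proof -
  have "continuous_on S (\<lambda>x. (x, t))" "(\<lambda>x. (x, t)) ` S \<subseteq> S \<times> I"
    using assms(2) by (auto intro!: continuous_intros)
  from continuous_on_compose2[OF assms(1) this] show ?thesis by simp
qed

lemma compact_slice_bound:
  fixes f :: "'a::heine_borel \<Rightarrow> real \<Rightarrow> 'b::real_normed_vector"
  assumes U: "bounded U" and cont: "continuous_on (closure U \<times> I) (\<lambda>z. f (fst z) (snd z))"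
    and t: "t \<in> I"
  shows "\<exists>B\<ge>0. \<forall>x\<in>closure U. norm (f x t) \<le> B"
proof -
  have "{t..t} \<subseteq> I" using t by simp
  from compact_slab_bound[OF U cont this] show ?thesis by simp
qed

lemma continuous_on_space_slice:
  assumes "continuous_on (S \<times> I) (\<lambda>z. f (fst z) (snd z))" "x \<in> S"
  shows "continuous_on I (f x)"
proof -
  have "continuous_on I (\<lambda>t. (x, t))" "(\<lambda>t. (x, t)) ` I \<subseteq> S \<times> I"
    using assms(2) by (auto intro!: continuous_intros)
  from continuous_on_compose2[OF assms(1) this] show ?thesis by simp
qed

section \<open>The energy estimate\<close>

text \<open>The derivatives are parameters because they stand for the continuous extensions to
  \<open>closure U\<close>; at boundary points the description operator in \<open>grad\<close> need
  not yield these values. Derivatives of \<open>u\<close> are continuous for \<open>t > 0\<close>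
  only, whereas \<open>u\<close>, \<open>\<Psi>\<close> and the derivatives of \<open>\<Psi>\<close>
  are so down to \<open>t = 0\<close>. The derivative \<open>DZ\<close> is the same at all points,
  \<open>Z\<close> being affine in \<open>x\<close>.\<close>

locale dirichlet_flow = forchheimer N \<alpha> a for N \<alpha> a +
  fixes U :: "(real^3) set" and k :: "real^3" and R T \<phi> M :: real
    and Z :: "real^3 \<Rightarrow> real \<Rightarrow> real^3" and DZ :: "real^3 \<Rightarrow> real^3"
    and u ut \<Psi> \<Psi>t :: "real^3 \<Rightarrow> real \<Rightarrow> real" and Du D\<Psi> :: "real^3 \<Rightarrow> real \<Rightarrow> real^3"
    and D2u :: "real^3 \<Rightarrow> real \<Rightarrow> real^3^3"
  assumes open_U: "open U" and bounded_U: "bounded U" and negligible_U: "negligible (frontier U)"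
    and norm_k: "norm k = 1" and R: "R \<ge> 0" and T: "T > 0" and \<phi>: "\<phi> > 0"
    and cont_Z: "continuous_on (closure U \<times> {0..T}) (\<lambda>z. Z (fst z) (snd z))"
    and der_Z: "\<And>x t. ((\<lambda>y. Z y t) has_derivative DZ) (at x)"
    and Z_le: "\<And>x t. x \<in> closure U \<Longrightarrow> t \<in> {0..T} \<Longrightarrow> norm (Z x t) \<le> M"
    and cont_u: "continuous_on (closure U \<times> {0..T}) (\<lambda>z. u (fst z) (snd z))"
    and cont_Du: "continuous_on (closure U \<times> {0<..T}) (\<lambda>z. Du (fst z) (snd z))"
    and cont_D2u: "continuous_on (closure U \<times> {0<..T}) (\<lambda>z. D2u (fst z) (snd z))"
    and cont_ut: "continuous_on (closure U \<times> {0<..T}) (\<lambda>z. ut (fst z) (snd z))"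
    and cont_\<Psi>: "continuous_on (closure U \<times> {0..T}) (\<lambda>z. \<Psi> (fst z) (snd z))"
    and cont_D\<Psi>: "continuous_on (closure U \<times> {0..T}) (\<lambda>z. D\<Psi> (fst z) (snd z))"
    and cont_\<Psi>t: "continuous_on (closure U \<times> {0..T}) (\<lambda>z. \<Psi>t (fst z) (snd z))"
    and der_u: "\<And>x t. x \<in> U \<Longrightarrow> t \<in> {0<..T} \<Longrightarrow> GDERIV (\<lambda>y. u y t) x :> Du x t"
    and der_Du: "\<And>x t. x \<in> U \<Longrightarrow> t \<in> {0<..T} \<Longrightarrow>
      ((\<lambda>y. Du y t) has_derivative (\<lambda>h. D2u x t *v h)) (at x)"
    and der_ut: "\<And>x t. x \<in> U \<Longrightarrow> t \<in> {0<..T} \<Longrightarrow>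
      (u x has_real_derivative ut x t) (at t within {0<..T})"
    and der_\<Psi>: "\<And>x t. x \<in> U \<Longrightarrow> t \<in> {0..T} \<Longrightarrow> GDERIV (\<lambda>y. \<Psi> y t) x :> D\<Psi> x t"
    and der_\<Psi>t: "\<And>x t. x \<in> U \<Longrightarrow> t \<in> {0..T} \<Longrightarrow>
      (\<Psi> x has_real_derivative \<Psi>t x t) (at t within {0..T})"
    and pde: "\<And>x t. x \<in> U \<Longrightarrow> t \<in> {0<..T} \<Longrightarrow>
      \<phi> * ut x t = divergence (\<lambda>y. X k R (Du y t + (u y t)\<^sup>2 *\<^sub>R Z y t)) x"
    and boundary: "\<And>x t. x \<in> frontier U \<Longrightarrow> t \<in> {0<..T} \<Longrightarrow> u x t = \<Psi> x t"
begin

definition flux :: "real^3 \<Rightarrow> real \<Rightarrow> real^3" where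
  "flux x t = Du x t + (u x t)\<^sup>2 *\<^sub>R Z x t"

definition w :: "real^3 \<Rightarrow> real \<Rightarrow> real" where "w x t = u x t - \<Psi> x t"

definition wt :: "real^3 \<Rightarrow> real \<Rightarrow> real" where "wt x t = ut x t - \<Psi>t x t"

definition weighted :: "real^3 \<Rightarrow> real \<Rightarrow> real" where
  "weighted x t = (1 + norm (flux x t)) powr (- a_exp N \<alpha>) * (norm (Du x t))\<^sup>2"

text \<open>The first summand is the error of \<open>pointwise_energy_estimate\<close>, the second
  bounds \<open>- \<phi> * w * \<Psi>t\<close>. All of it is continuous down to
  \<open>t = 0\<close>, which makes it integrable over the whole cylinder.\<close>

definition source :: "real^3 \<Rightarrow> real \<Rightarrow> real" where
  "source x t = source_const * (M\<^sup>2 * u x t ^ 4 + (norm (D\<Psi> x t))\<^sup>2)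
     + \<phi> * ((\<Psi>t x t)\<^sup>2 + (\<Psi> x t)\<^sup>2 + (u x t)\<^sup>2)"

section \<open>Continuity and integrability of the quantities involved\<close>

lemma subset_closure: "U \<subseteq> closure U"
  by (rule closure_subset)

lemma cont_pos:
  assumes "continuous_on (closure U \<times> {0..T}) (\<lambda>z. f (fst z) (snd z))"
  shows "continuous_on (closure U \<times> {0<..T}) (\<lambda>z. f (fst z) (snd z))"
  by (rule continuous_on_subset[OF assms]) auto

lemma cont_flux: "continuous_on (closure U \<times> {0<..T}) (\<lambda>z. flux (fst z) (snd z))"
  unfolding flux_def by (intro continuous_intros cont_pos[OF cont_u] cont_pos[OF cont_Z] cont_Du)

lemma cont_w: "continuous_on (closure U \<times> {0..T}) (\<lambda>z. w (fst z) (snd z))"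
  unfolding w_def by (intro continuous_intros cont_u cont_\<Psi>)

lemma cont_wt: "continuous_on (closure U \<times> {0<..T}) (\<lambda>z. wt (fst z) (snd z))"
  unfolding wt_def by (intro continuous_intros cont_ut cont_pos[OF cont_\<Psi>t])

lemma cont_weighted: "continuous_on (closure U \<times> {0<..T}) (\<lambda>z. weighted (fst z) (snd z))"
  unfolding weighted_def
proof (intro continuous_intros cont_flux cont_Du ballI)
  fix z :: "(real^3) \<times> real"
  show "1 + norm (flux (fst z) (snd z)) \<noteq> 0" by (smt (verit) norm_ge_zero)
qed

lemma cont_source: "continuous_on (closure U \<times> {0..T}) (\<lambda>z. source (fst z) (snd z))"
  unfolding source_def by (intro continuous_intros cont_u cont_\<Psi> cont_D\<Psi> cont_\<Psi>t)

lemma weighted_nonneg: "0 \<le> weighted x t"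
  by (simp add: weighted_def)

lemma source_nonneg: "0 \<le> source x t"
  using source_const_pos \<phi> by (auto simp: source_def intro!: add_nonneg_nonneg mult_nonneg_nonneg)

text \<open>The set \<open>J\<close> is separate from the compact slab that supplies the bound, so
  that closed slabs and the open cylinder are both covered.\<close>

lemma integrable_slab:
  fixes f :: "real^3 \<Rightarrow> real \<Rightarrow> real"
  assumes cont: "continuous_on (closure U \<times> I) (\<lambda>z. f (fst z) (snd z))" and I: "{\<tau>..T} \<subseteq> I"
    and J: "J \<subseteq> {\<tau>..T}" "J \<in> sets borel"
  shows "set_integrable lborel (U \<times> J) (\<lambda>z. f (fst z) (snd z))"
proof -
  obtain B where B: "\<forall>x\<in>closure U. \<forall>t\<in>{\<tau>..T}. norm (f x t) \<le> B"
    using compact_slab_bound[OF bounded_U cont I] by blast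
  show ?thesis
  proof (rule set_integrable_bounded[where B = B])
    show "U \<times> J \<in> sets borel" using open_U J(2) by (intro borel_Times) auto
    have "bounded J" using J(1) bounded_closed_interval bounded_subset by blast
    then show "bounded (U \<times> J)" using bounded_U by (intro bounded_Times)
    show "continuous_on (U \<times> J) (\<lambda>z. f (fst z) (snd z))"
      using J(1) I subset_closure by (intro continuous_on_subset[OF cont]) auto
    show "\<bar>f (fst z) (snd z)\<bar> \<le> B" if "z \<in> U \<times> J" for z
    proof -
      have "fst z \<in> closure U" "snd z \<in> {\<tau>..T}" using that J(1) subset_closure by auto
      with B show ?thesis by simp
    qed
  qed
qed

lemma integrable_slice:
  fixes f :: "real^3 \<Rightarrow> real \<Rightarrow> real"
  assumes cont: "continuous_on (closure U \<times> I) (\<lambda>z. f (fst z) (snd z))" and t: "t \<in> I"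
  shows "set_integrable lborel U (\<lambda>x. f x t)"
proof -
  have c: "continuous_on (closure U) (\<lambda>x. f x t)" by (rule continuous_on_time_slice[OF cont t])
  have "compact (closure U)" using bounded_U by (simp add: compact_closure)
  with c have "bounded ((\<lambda>x. f x t) ` closure U)" by (intro compact_imp_bounded compact_continuous_image)
  then obtain B where "\<And>x. x \<in> closure U \<Longrightarrow> \<bar>f x t\<bar> \<le> B" by (auto simp: bounded_iff)
  then show ?thesis
    using open_U bounded_U subset_closure
    by (intro set_integrable_bounded[where B = B] continuous_on_subset[OF c]) auto
qed

section \<open>The weak form at a fixed time\<close>

lemma flux_has_derivative:
  assumes x: "x \<in> U" and t: "t \<in> {0<..T}"
  shows "((\<lambda>y. flux y t) has_derivative (\<lambda>h. D2u x t *v h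
     + ((u x t)\<^sup>2 *\<^sub>R DZ h + (2 * u x t * (h \<bullet> Du x t)) *\<^sub>R Z x t))) (at x)"
proof -
  have "((\<lambda>y. u y t) has_derivative (\<lambda>h. h \<bullet> Du x t)) (at x)"
    using der_u[OF x t] by (simp add: gderiv_def)
  then have "((\<lambda>y. (u y t)\<^sup>2) has_derivative (\<lambda>h. 2 * u x t * (h \<bullet> Du x t))) (at x)"
    by (auto intro!: derivative_eq_intros)
  from has_derivative_add[OF der_Du[OF x t] has_derivative_scaleR[OF this der_Z]]
  show ?thesis by (simp add: flux_def)
qed

text \<open>At a fixed \<open>t > 0\<close> the data are bounded on the compact closure of
  \<open>U\<close>, and the derivative of \<open>X\<close> is bounded by \<open>1 / a 0\<close>
  everywhere. The chain rule thus gives one bound for all of \<open>U\<close>, as the integration by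
  parts requires.\<close>

lemma X_flux_derivative:
  assumes t: "t \<in> {0<..T}"
  shows "\<exists>D. \<exists>B\<ge>0. \<forall>x\<in>U. ((\<lambda>y. X k R (flux y t)) has_derivative D x) (at x) \<and>
    (\<forall>h. norm (D x h) \<le> B * norm h)"
proof -
  have t0: "t \<in> {0..T}" using t by simp
  obtain B1 where B1: "B1 \<ge> 0" "\<And>x. x \<in> closure U \<Longrightarrow> norm (D2u x t) \<le> B1"
    using compact_slice_bound[OF bounded_U cont_D2u t] by blast
  obtain B2 where B2: "B2 \<ge> 0" "\<And>x. x \<in> closure U \<Longrightarrow> norm (Du x t) \<le> B2"
    using compact_slice_bound[OF bounded_U cont_Du t] by blast
  obtain B3 where B3: "B3 \<ge> 0" "\<And>x. x \<in> closure U \<Longrightarrow> norm (u x t) \<le> B3"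
    using compact_slice_bound[OF bounded_U cont_u t0] by blast
  obtain B4 where B4: "B4 \<ge> 0" "\<And>x. x \<in> closure U \<Longrightarrow> norm (Z x t) \<le> B4"
    using compact_slice_bound[OF bounded_U cont_Z t0] by blast
  have blZ: "bounded_linear DZ" using der_Z[of 0 0] by (rule has_derivative_bounded_linear)
  \<comment> \<open>The \<open>9\<close> counts the entries of the second derivative, each bounded
    by \<open>B1\<close>; the bracket is the product rule for \<open>u^2 Z\<close>.\<close>
  define BF where "BF = 9 * B1 + (B3\<^sup>2 * onorm DZ + 2 * B3 * B2 * B4)"
  have BF: "BF \<ge> 0" using B1 B2 B3 B4 onorm_pos_le[OF blZ] by (simp add: BF_def)
  define DF where "DF x h = D2u x t *v h + ((u x t)\<^sup>2 *\<^sub>R DZ h + (2 * u x t * (h \<bullet> Du x t)) *\<^sub>R Z x t)" for x h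
  have DF: "norm (DF x h) \<le> BF * norm h" if x: "x \<in> U" for x h
  proof -
    have xc: "x \<in> closure U" using x subset_closure by blast
    have "\<bar>D2u x t $ i $ j\<bar> \<le> B1" for i j
      using component_le_norm_cart[of "D2u x t $ i" j] 
        Finite_Cartesian_Product.norm_nth_le[of "D2u x t" i] B1(2)[OF xc] by simp
    then have "onorm ((*v) (D2u x t)) \<le> real CARD(3) * real CARD(3) * B1" by (rule onorm_le_matrix_component)
    then have "norm (D2u x t *v h) \<le> 9 * B1 * norm h"
      using onorm[OF matrix_vector_mul_bounded_linear[of "D2u x t"], of h]
        mult_right_mono[of "onorm ((*v) (D2u x t))" "9 * B1" "norm h"] by simp
    moreover have "norm ((u x t)\<^sup>2 *\<^sub>R DZ h) \<le> B3\<^sup>2 * (onorm DZ * norm h)"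
      unfolding norm_scaleR using B3(2)[OF xc] onorm[OF blZ, of h]
      by (intro mult_mono) (auto simp: abs_le_square_iff[symmetric] B3)
    moreover have "norm ((2 * u x t * (h \<bullet> Du x t)) *\<^sub>R Z x t) \<le> 2 * B3 * (norm h * B2) * B4"
    proof -
      have "\<bar>h \<bullet> Du x t\<bar> \<le> norm h * B2"
        using Cauchy_Schwarz_ineq2[of h "Du x t"] mult_left_mono[OF B2(2)[OF xc], of "norm h"] by simp
      then show ?thesis
        unfolding norm_scaleR abs_mult using B3 B3(2)[OF xc] B2(1) B4(2)[OF xc]
        by (intro mult_mono) auto
    qed
    ultimately have "norm (DF x h) \<le> 9 * B1 * norm h + (B3\<^sup>2 * (onorm DZ * norm h) + 2 * B3 * (norm h * B2) * B4)"
      unfolding DF_def by (intro norm_triangle_le add_mono) auto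
    then show ?thesis by (simp add: BF_def algebra_simps)
  qed
  have "\<exists>D. \<forall>h. ((\<lambda>y. X k R (flux y t)) has_derivative D) (at x) \<and> norm (D h) \<le> BF / a 0 * norm h"
    if x: "x \<in> U" for x
  proof -
    obtain E where E: "(X k R has_derivative E) (at (flux x t))" "\<And>h. norm (E h) \<le> norm h / a 0"
      using X_has_derivative by blast
    have "((\<lambda>y. X k R (flux y t)) has_derivative (\<lambda>h. E (DF x h))) (at x)"
      using flux_has_derivative[OF x t] E(1) unfolding DF_def by (rule has_derivative_compose)
    moreover have "norm (E (DF x h)) \<le> BF / a 0 * norm h" for h
      using E(2)[of "DF x h"] divide_right_mono[OF DF[OF x, of h], of "a 0"] a0_pos by simp
    ultimately show ?thesis by blast
  qed
  then obtain D where "\<forall>x\<in>U. \<forall>h. ((\<lambda>y. X k R (flux y t)) has_derivative D x) (at x) \<and> norm (D x h) \<le> BF / a 0 * norm h"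
    by metis
  then show ?thesis using BF a0_pos by (intro exI[of _ D] exI[of _ "BF / a 0"]) simp
qed

lemma weak_form:
  assumes t: "t \<in> {0<..T}"
  shows "set_integrable lborel U (\<lambda>x. \<phi> * w x t * ut x t + X k R (flux x t) \<bullet> (Du x t - D\<Psi> x t))"
    and "(LINT x:U|lborel. \<phi> * w x t * ut x t + X k R (flux x t) \<bullet> (Du x t - D\<Psi> x t)) = 0"
proof -
  let ?V = "\<lambda>y. X k R (flux y t)"
  have t0: "t \<in> {0..T}" using t by simp
  obtain D B where B: "B \<ge> 0" "\<And>x. x \<in> U \<Longrightarrow> (?V has_derivative D x) (at x)"
      "\<And>x h. x \<in> U \<Longrightarrow> norm (D x h) \<le> B * norm h"
    using X_flux_derivative[OF t] by blast
  have cV: "continuous_on (closure U \<times> {0<..T}) (\<lambda>z. X k R (flux (fst z) (snd z)))"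
    by (rule continuous_on_compose2[OF continuous_X cont_flux]) auto
  have cD: "continuous_on (closure U \<times> {0<..T}) (\<lambda>z. Du (fst z) (snd z) - D\<Psi> (fst z) (snd z))"
    by (intro continuous_intros cont_Du cont_pos[OF cont_D\<Psi>])
  obtain B1 where B1: "B1 \<ge> 0" "\<And>x. x \<in> closure U \<Longrightarrow> norm (w x t) \<le> B1"
    using compact_slice_bound[OF bounded_U cont_w t0] by blast
  obtain B2 where B2: "B2 \<ge> 0" "\<And>x. x \<in> closure U \<Longrightarrow> norm (X k R (flux x t)) \<le> B2"
    using compact_slice_bound[OF bounded_U cV t] by blast
  obtain B3 where B3: "B3 \<ge> 0" "\<And>x. x \<in> closure U \<Longrightarrow> norm (Du x t - D\<Psi> x t) \<le> B3"
    using compact_slice_bound[OF bounded_U cD t] by blast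
  note id = integral_divergence_eq_0[OF open_U bounded_U negligible_U
      continuous_on_time_slice[OF cont_w t0] _ continuous_on_time_slice[OF cV t] _ B(2) _ _ _ B(3)
      B1(1) B2(1) B3(1) B(1), of "\<lambda>x. Du x t - D\<Psi> x t"]
  have 1: "w x t = 0" if "x \<in> frontier U" for x using boundary[OF that t] by (simp add: w_def)
  have 2: "GDERIV (\<lambda>x. w x t) x :> Du x t - D\<Psi> x t" if "x \<in> U" for x
    unfolding w_def by (rule GDERIV_diff[OF der_u[OF that t] der_\<Psi>[OF that t0]])
  have 3: "\<bar>w x t\<bar> \<le> B1" "norm (?V x) \<le> B2" "norm (Du x t - D\<Psi> x t) \<le> B3" if "x \<in> U" for x
    using B1(2)[of x] B2(2)[of x] B3(2)[of x] that subset_closure by auto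
  have eq: "\<phi> * w x t * ut x t + X k R (flux x t) \<bullet> (Du x t - D\<Psi> x t)
      = w x t * divergence ?V x + ?V x \<bullet> (Du x t - D\<Psi> x t)" if "x \<in> U" for x
    using pde[OF that t] by (simp add: flux_def mult_ac)
  have U: "U \<in> sets lborel" using open_U by simp
  have "set_integrable lborel U (\<lambda>x. w x t * divergence ?V x + ?V x \<bullet> (Du x t - D\<Psi> x t))"
    using id(1) 1 2 3 by blast
  then show "set_integrable lborel U (\<lambda>x. \<phi> * w x t * ut x t + X k R (flux x t) \<bullet> (Du x t - D\<Psi> x t))"
    using eq by (subst set_integrable_cong) auto
  have "(LINT x:U|lborel. w x t * divergence ?V x + ?V x \<bullet> (Du x t - D\<Psi> x t)) = 0"
    using id(2) 1 2 3 by blast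
  then show "(LINT x:U|lborel. \<phi> * w x t * ut x t + X k R (flux x t) \<bullet> (Du x t - D\<Psi> x t)) = 0"
    using eq U by (subst set_lebesgue_integral_cong) auto
qed

text \<open>Writing \<open>ut\<close> as \<open>wt + \<Psi>t\<close> isolates \<open>w * wt\<close>,
  the exact time derivative of \<open>w^2 / 2\<close>; the rest is moved into
  \<open>source\<close>.\<close>

lemma pointwise_energy_inequality:
  assumes x: "x \<in> U" and t: "t \<in> {0<..T}"
  shows "weighted x t / weight_const R + \<phi> * w x t * wt x t - source x t
    \<le> \<phi> * w x t * ut x t + X k R (flux x t) \<bullet> (Du x t - D\<Psi> x t)"
proof -
  have Z: "norm (Z x t) \<le> M" using x t subset_closure by (intro Z_le) auto
  have 1: "weighted x t / weight_const R
      \<le> X k R (flux x t) \<bullet> (Du x t - D\<Psi> x t)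
        + source_const * (M\<^sup>2 * u x t ^ 4 + (norm (D\<Psi> x t))\<^sup>2)"
    using pointwise_energy_estimate[OF norm_k R Z, of "Du x t" "u x t" "D\<Psi> x t"]
    by (simp add: weighted_def flux_def)
  \<comment> \<open>Twice \<open>- w * \<Psi>t\<close> is at most \<open>w^2 + \<Psi>t^2\<close>,
    and \<open>w^2 \<le> 2 u^2 + 2 \<Psi>^2\<close> by the second square.\<close>
  have "0 \<le> (w x t + \<Psi>t x t)\<^sup>2" by simp
  moreover have "0 \<le> (u x t + \<Psi> x t)\<^sup>2" by simp
  ultimately have "- (w x t * \<Psi>t x t) \<le> (\<Psi>t x t)\<^sup>2 + (\<Psi> x t)\<^sup>2 + (u x t)\<^sup>2"
    by (simp add: w_def power2_eq_square algebra_simps)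
       (smt (verit) zero_le_square)
  then have "\<phi> * (- (w x t * \<Psi>t x t)) \<le> \<phi> * ((\<Psi>t x t)\<^sup>2 + (\<Psi> x t)\<^sup>2 + (u x t)\<^sup>2)"
    using \<phi> by (intro mult_left_mono) auto
  moreover have "\<phi> * w x t * wt x t = \<phi> * w x t * ut x t + \<phi> * (- (w x t * \<Psi>t x t))"
    by (simp add: wt_def algebra_simps)
  ultimately show ?thesis using 1 unfolding source_def by linarith
qed

section \<open>The energy inequality, from one time to the cylinder\<close>

lemma energy_slice:
  assumes t: "t \<in> {0<..T}"
  shows "(LINT x:U|lborel. weighted x t / weight_const R + \<phi> * w x t * wt x t - source x t) \<le> 0"
proof -
  have cont: "continuous_on (closure U \<times> {0<..T}) (\<lambda>z. weighted (fst z) (snd z) / weight_const R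
      + \<phi> * w (fst z) (snd z) * wt (fst z) (snd z) - source (fst z) (snd z))"
    by (intro continuous_intros cont_weighted cont_pos[OF cont_w] cont_wt cont_pos[OF cont_source])
       (use weight_const_pos[OF R] in auto)
  have "(LINT x:U|lborel. weighted x t / weight_const R + \<phi> * w x t * wt x t - source x t)
      \<le> (LINT x:U|lborel. \<phi> * w x t * ut x t + X k R (flux x t) \<bullet> (Du x t - D\<Psi> x t))"
    using integrable_slice[OF cont t] weak_form(1)[OF t] pointwise_energy_inequality[OF _ t]
    by (intro set_integral_mono) auto
  then show ?thesis using weak_form(2)[OF t] by simp
qed

text \<open>Integrating in time first reduces this to the fundamental theorem of calculus at each
  \<open>x\<close>, with no differentiation under the integral. It requires
  \<open>\<tau> > 0\<close>, since \<open>ut\<close> is continuous for positive times only.\<close>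

lemma integral_time_derivative:
  assumes \<tau>: "0 < \<tau>" "\<tau> \<le> T"
  shows "(LINT z:U\<times>{\<tau>..T}|lborel. w (fst z) (snd z) * wt (fst z) (snd z))
    = ((LINT x:U|lborel. (w x T)\<^sup>2) - (LINT x:U|lborel. (w x \<tau>)\<^sup>2)) / 2"
proof -
  have I: "{\<tau>..T} \<subseteq> {0<..T}" "{\<tau>..T} \<subseteq> {0..T}" using \<tau> by auto
  have cont: "continuous_on (closure U \<times> {0<..T}) (\<lambda>z. w (fst z) (snd z) * wt (fst z) (snd z))"
    by (intro continuous_intros cont_pos[OF cont_w] cont_wt)
  have "set_integrable lborel (U \<times> {\<tau>..T}) (\<lambda>z. w (fst z) (snd z) * wt (fst z) (snd z))"
    by (rule integrable_slab[OF cont I(1)]) auto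
  from cylinder_Fubini(2)[OF this]
  have "(LINT z:U\<times>{\<tau>..T}|lborel. w (fst z) (snd z) * wt (fst z) (snd z))
      = (LINT x:U|lborel. (LINT t:{\<tau>..T}|lborel. w x t * wt x t))" .
  also have "\<dots> = (LINT x:U|lborel. ((w x T)\<^sup>2 - (w x \<tau>)\<^sup>2) / 2)"
  proof (intro set_lebesgue_integral_cong ballI allI impI)
    fix x assume x: "x \<in> U"
    have "((\<lambda>t. (w x t)\<^sup>2 / 2) has_vector_derivative w x t * wt x t) (at t within {\<tau>..T})"
      if t: "\<tau> \<le> t" "t \<le> T" for t
    proof -
      have "(u x has_real_derivative ut x t) (at t within {\<tau>..T})"
        by (rule DERIV_subset[OF der_ut[OF x] I(1)]) (use t \<tau> in auto)
      moreover have "(\<Psi> x has_real_derivative \<Psi>t x t) (at t within {\<tau>..T})"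
        by (rule DERIV_subset[OF der_\<Psi>t[OF x] I(2)]) (use t \<tau> in auto)
      ultimately have "((\<lambda>t. (w x t)\<^sup>2 / 2) has_real_derivative w x t * wt x t) (at t within {\<tau>..T})"
        unfolding w_def wt_def by (auto intro!: derivative_eq_intros)
      then show ?thesis by (simp add: has_real_derivative_iff_has_vector_derivative)
    qed
    moreover have "continuous_on {\<tau>..T} (\<lambda>t. w x t * wt x t)"
      using x subset_closure I
      by (intro continuous_on_subset[OF continuous_on_space_slice[OF cont]]) auto
    ultimately show "(LINT t:{\<tau>..T}|lborel. w x t * wt x t) = ((w x T)\<^sup>2 - (w x \<tau>)\<^sup>2) / 2"
      using integral_FTC_atLeastAtMost[of \<tau> T "\<lambda>t. (w x t)\<^sup>2 / 2" "\<lambda>t. w x t * wt x t"] \<tau>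
      by (simp add: set_lebesgue_integral_def diff_divide_distrib)
  qed (use open_U in simp)
  also have "\<dots> = ((LINT x:U|lborel. (w x T)\<^sup>2) - (LINT x:U|lborel. (w x \<tau>)\<^sup>2)) / 2"
  proof -
    have c2: "continuous_on (closure U \<times> {0..T}) (\<lambda>z. (w (fst z) (snd z))\<^sup>2)"
      by (intro continuous_intros cont_w)
    have "set_integrable lborel U (\<lambda>x. (w x T)\<^sup>2)" "set_integrable lborel U (\<lambda>x. (w x \<tau>)\<^sup>2)"
      using integrable_slice[OF c2, of T] integrable_slice[OF c2, of \<tau>] \<tau> by auto
    then show ?thesis by (simp add: set_integral_diff)
  qed
  finally show ?thesis .
qed

text \<open>Compactness arguments live on the closed time interval, the statement integrates over
  the open one; they differ by a null set.\<close>

lemma integral_closed_slab_eq_open: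
  fixes f :: "real^3 \<Rightarrow> real \<Rightarrow> real"
  assumes cont: "continuous_on (closure U \<times> {0..T}) (\<lambda>z. f (fst z) (snd z))"
  shows "(LINT z:U\<times>{0..T}|lborel. f (fst z) (snd z)) = (LINT z:U\<times>{0<..<T}|lborel. f (fst z) (snd z))"
proof -
  have i1: "set_integrable lborel (U \<times> {0..T}) (\<lambda>z. f (fst z) (snd z))"
    by (rule integrable_slab[OF cont order_refl]) auto
  have i2: "set_integrable lborel (U \<times> {0<..<T}) (\<lambda>z. f (fst z) (snd z))"
    by (rule integrable_slab[OF cont order_refl]) auto
  have "AE t in lborel. t \<noteq> 0 \<and> t \<noteq> T"
    using AE_lborel_singleton[of "0::real"] AE_lborel_singleton[of T] by eventually_elim simp
  then have "AE t in lborel. t \<in> {0..T} \<longleftrightarrow> t \<in> {0<..<T}" by eventually_elim auto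
  then have "(LINT t:{0..T}|lborel. (LINT x:U|lborel. f x t)) = (LINT t:{0<..<T}|lborel. (LINT x:U|lborel. f x t))"
    using cylinder_Fubini(3)[OF i1] cylinder_Fubini(3)[OF i2]
    by (intro set_integral_cong_set)
       (auto simp: set_integrable_def set_borel_measurable_def dest: borel_measurable_integrable)
  then show ?thesis using cylinder_Fubini(1)[OF i1] cylinder_Fubini(1)[OF i2] by simp
qed

text \<open>The energy at time \<open>T\<close> is nonnegative and is dropped, and the source is
  enlarged to the full cylinder. Then only the energy at time \<open>\<tau>\<close> still depends on
  \<open>\<tau>\<close> on the right.\<close>

lemma energy_slab:
  assumes \<tau>: "0 < \<tau>" "\<tau> \<le> T"
  shows "(LINT z:U\<times>{\<tau>..T}|lborel. weighted (fst z) (snd z))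
    \<le> weight_const R * (\<phi> / 2 * (LINT x:U|lborel. (w x \<tau>)\<^sup>2)
        + (LINT z:U\<times>{0<..<T}|lborel. source (fst z) (snd z)))"
proof -
  let ?I = "\<lambda>f. LINT z:U\<times>{\<tau>..T}|lborel. f (fst z) (snd z)"
  have I: "{\<tau>..T} \<subseteq> {0<..T}" "{\<tau>..T} \<subseteq> {0..T}" using \<tau> by auto
  have wc: "weight_const R > 0" by (rule weight_const_pos[OF R])
  have cont: "continuous_on (closure U \<times> {0<..T}) (\<lambda>z. w (fst z) (snd z) * wt (fst z) (snd z))"
    by (intro continuous_intros cont_pos[OF cont_w] cont_wt)
  have i1: "set_integrable lborel (U \<times> {\<tau>..T}) (\<lambda>z. weighted (fst z) (snd z))"
    by (rule integrable_slab[OF cont_weighted I(1)]) auto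
  have i2: "set_integrable lborel (U \<times> {\<tau>..T}) (\<lambda>z. w (fst z) (snd z) * wt (fst z) (snd z))"
    by (rule integrable_slab[OF cont I(1)]) auto
  have i3: "set_integrable lborel (U \<times> {\<tau>..T}) (\<lambda>z. source (fst z) (snd z))"
    by (rule integrable_slab[OF cont_source I(2)]) auto
  have i4: "set_integrable lborel (U \<times> {0..T}) (\<lambda>z. source (fst z) (snd z))"
    by (rule integrable_slab[OF cont_source order_refl]) auto
  define q where "q x t = weighted x t / weight_const R + \<phi> * (w x t * wt x t) - source x t" for x t
  have iq: "set_integrable lborel (U \<times> {\<tau>..T}) (\<lambda>z. q (fst z) (snd z))"
    unfolding q_def using i1 i2 i3 by (intro set_integral_diff set_integral_add) auto
  have "?I q = (LINT t:{\<tau>..T}|lborel. (LINT x:U|lborel. q x t))"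
    by (rule cylinder_Fubini(1)[OF iq])
  also have "\<dots> \<le> (LINT t:{\<tau>..T}|lborel. 0)"
    using cylinder_Fubini(3)[OF iq] energy_slice I
    by (intro set_integral_mono) (auto simp: q_def mult.assoc set_integrable_def subset_iff)
  finally have "?I q \<le> 0" by (simp add: set_lebesgue_integral_def)
  moreover have "?I q = ?I weighted / weight_const R
      + \<phi> * (LINT z:U\<times>{\<tau>..T}|lborel. w (fst z) (snd z) * wt (fst z) (snd z)) - ?I source"
    unfolding q_def using i1 i2 i3 by (simp add: set_integral_add set_integral_diff)
  moreover have "?I source \<le> (LINT z:U\<times>{0<..<T}|lborel. source (fst z) (snd z))"
  proof -
    have "?I source \<le> (LINT z:U\<times>{0..T}|lborel. source (fst z) (snd z))"
      unfolding set_lebesgue_integral_def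
      using i3 i4 source_nonneg \<tau>
      by (intro integral_mono) (auto simp: set_integrable_def indicator_def)
    then show ?thesis by (simp add: integral_closed_slab_eq_open[OF cont_source])
  qed
  moreover have "\<phi> * (LINT z:U\<times>{\<tau>..T}|lborel. w (fst z) (snd z) * wt (fst z) (snd z))
      \<ge> - (\<phi> / 2 * (LINT x:U|lborel. (w x \<tau>)\<^sup>2))"
  proof -
    have "0 \<le> \<phi> * (LINT x:U|lborel. (w x T)\<^sup>2) / 2"
      using \<phi> by (intro divide_nonneg_pos mult_nonneg_nonneg set_integral_nonneg) auto
    then show ?thesis by (simp add: integral_time_derivative[OF \<tau>] algebra_simps diff_divide_distrib)
  qed
  ultimately have "?I weighted / weight_const R \<le> \<phi> / 2 * (LINT x:U|lborel. (w x \<tau>)\<^sup>2)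
        + (LINT z:U\<times>{0<..<T}|lborel. source (fst z) (snd z))"
    by linarith
  then show ?thesis using wc by (simp add: divide_le_eq mult.commute)
qed

text \<open>Continuity of \<open>w\<close> down to \<open>t = 0\<close> on the compact cylinder
  gives pointwise convergence and a common bound; no derivative of \<open>u\<close> enters.\<close>

lemma tendsto_initial_energy:
  assumes \<tau>: "\<tau> \<longlonglongrightarrow> 0" "\<And>n. \<tau> n \<in> {0..T}"
  shows "(\<lambda>n. LINT x:U|lborel. (w x (\<tau> n))\<^sup>2) \<longlonglongrightarrow> (LINT x:U|lborel. (w x 0)\<^sup>2)"
proof -
  have c2: "continuous_on (closure U \<times> {0..T}) (\<lambda>z. (w (fst z) (snd z))\<^sup>2)"
    by (intro continuous_intros cont_w)
  have t0: "0 \<in> {0..T}" using T by simp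
  obtain B where B: "\<forall>x\<in>closure U. \<forall>t\<in>{0..T}. norm ((w x t)\<^sup>2) \<le> B"
    using compact_slab_bound[OF bounded_U c2 order_refl] by blast
  have fin: "emeasure lborel U < \<infinity>" using bounded_U by (rule emeasure_bounded_finite)
  have U: "U \<in> sets lborel" using open_U by simp
  have meas: "(\<lambda>x. indicator U x *\<^sub>R (w x t)\<^sup>2) \<in> borel_measurable lborel" if "t \<in> {0..T}" for t
    using integrable_slice[OF c2 that] unfolding set_integrable_def by (rule borel_measurable_integrable)
  show ?thesis
    unfolding set_lebesgue_integral_def
  proof (rule integral_dominated_convergence[where w = "\<lambda>x. B * indicator U x"])
    show "integrable lborel (\<lambda>x. B * indicator U x)"
      using U fin by (intro integrable_mult_right integrable_real_indicator) auto
    show "AE x in lborel. (\<lambda>n. indicator U x *\<^sub>R (w x (\<tau> n))\<^sup>2) \<longlonglongrightarrow> indicator U x *\<^sub>R (w x 0)\<^sup>2"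
    proof (intro always_eventually allI)
      fix x
      show "(\<lambda>n. indicator U x *\<^sub>R (w x (\<tau> n))\<^sup>2) \<longlonglongrightarrow> indicator U x *\<^sub>R (w x 0)\<^sup>2"
      proof (cases "x \<in> U")
        case True
        then have "continuous_on {0..T} (w x)"
          using subset_closure by (intro continuous_on_space_slice[OF cont_w]) auto
        then have "(\<lambda>n. w x (\<tau> n)) \<longlonglongrightarrow> w x 0"
          using \<tau> t0 by (intro continuous_on_tendsto_compose[of "{0..T}" "w x"]) auto
        then show ?thesis by (intro tendsto_intros)
      qed simp
    qed
    show "AE x in lborel. norm (indicator U x *\<^sub>R (w x (\<tau> n))\<^sup>2) \<le> B * indicator U x" for n
      using B \<tau>(2)[of n] subset_closure by (intro always_eventually allI) (auto simp: indicator_def)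
  qed (use meas \<tau>(2) t0 in auto)
qed

lemma energy_estimate:
  "(\<integral>\<^sup>+z\<in>U\<times>{0<..<T}. ennreal (weighted (fst z) (snd z)) \<partial>lborel)
    \<le> ennreal (weight_const R * (\<phi> / 2 * (LINT x:U|lborel. (w x 0)\<^sup>2)
        + (LINT z:U\<times>{0<..<T}|lborel. source (fst z) (snd z))))"
proof (rule nn_integral_cylinder_exhaustion)
  show "U \<in> sets borel" using open_U by simp
  show "T > 0" by (rule T)
  show "continuous_on (U \<times> {0<..T}) (\<lambda>z. weighted (fst z) (snd z))"
    using subset_closure by (intro continuous_on_subset[OF cont_weighted]) auto
  define \<tau> where "\<tau> n = T / real (n + 2)" for n
  have \<tau>: "0 < \<tau> n" "\<tau> n \<le> T" for n using T by (auto simp: \<tau>_def divide_le_eq)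
  show "(\<integral>\<^sup>+z\<in>U\<times>{T / real (n + 2)..T}. ennreal (weighted (fst z) (snd z)) \<partial>lborel)
      \<le> ennreal (weight_const R * (\<phi> / 2 * (LINT x:U|lborel. (w x (\<tau> n))\<^sup>2)
        + (LINT z:U\<times>{0<..<T}|lborel. source (fst z) (snd z))))" for n
  proof -
    have "set_integrable lborel (U \<times> {\<tau> n..T}) (\<lambda>z. weighted (fst z) (snd z))"
      using \<tau>[of n] by (intro integrable_slab[OF cont_weighted, of "\<tau> n"]) auto
    then have "(\<integral>\<^sup>+z\<in>U\<times>{\<tau> n..T}. ennreal (weighted (fst z) (snd z)) \<partial>lborel)
        = ennreal (LINT z:U\<times>{\<tau> n..T}|lborel. weighted (fst z) (snd z))"
      using weighted_nonneg by (intro nn_integral_eq_LINT) auto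
    also have "\<dots> \<le> ennreal (weight_const R * (\<phi> / 2 * (LINT x:U|lborel. (w x (\<tau> n))\<^sup>2)
        + (LINT z:U\<times>{0<..<T}|lborel. source (fst z) (snd z))))"
      by (intro ennreal_leI energy_slab \<tau>)
    finally show ?thesis by (simp add: \<tau>_def)
  qed
  have "(\<lambda>n. T * inverse (real (Suc (Suc n)))) \<longlonglongrightarrow> T * 0"
    by (intro tendsto_intros LIMSEQ_Suc[OF LIMSEQ_inverse_real_of_nat])
  then have "\<tau> \<longlonglongrightarrow> 0" by (simp add: \<tau>_def[abs_def] divide_inverse)
  then show "(\<lambda>n. weight_const R * (\<phi> / 2 * (LINT x:U|lborel. (w x (\<tau> n))\<^sup>2)
        + (LINT z:U\<times>{0<..<T}|lborel. source (fst z) (snd z))))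
      \<longlonglongrightarrow> weight_const R * (\<phi> / 2 * (LINT x:U|lborel. (w x 0)\<^sup>2)
        + (LINT z:U\<times>{0<..<T}|lborel. source (fst z) (snd z)))"
    using \<tau> by (intro tendsto_intros tendsto_initial_energy) (auto simp: less_imp_le)
qed

section \<open>Passage to the quantities of the statement\<close>

definition data_energy :: "real^3 \<Rightarrow> real \<Rightarrow> real" where
  "data_energy x t = chi1 N \<alpha> a R powr (2 * (2 + a_exp N \<alpha>)) * (norm (D\<Psi> x t))\<^sup>2
    + \<phi> * (chi1 N \<alpha> a R)\<^sup>2 * ((\<Psi>t x t)\<^sup>2 + (\<Psi> x t)\<^sup>2)"

lemma cont_data_energy: "continuous_on (closure U \<times> {0..T}) (\<lambda>z. data_energy (fst z) (snd z))"
  unfolding data_energy_def by (intro continuous_intros cont_\<Psi> cont_D\<Psi> cont_\<Psi>t)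

text \<open>The factor \<open>chi1^2\<close> of \<open>weight_const\<close> is distributed over the
  source, term by term: it is kept in front of \<open>\<phi>\<close>, raised to the power of
  \<open>1 + chi1\<close> for the fourth power of \<open>u\<close>, and raised by
  \<open>chi1_sq_le\<close> for the gradient of \<open>\<Psi>\<close>.\<close>

lemma source_le:
  "(chi1 N \<alpha> a R)\<^sup>2 * source x t \<le> data_const * ((chi1 N \<alpha> a R)\<^sup>2 * \<phi> * (u x t)\<^sup>2
    + (1 + chi1 N \<alpha> a R) powr (2 * (2 + a_exp N \<alpha>)) * M\<^sup>2 * u x t ^ 4 + data_energy x t)"
proof -
  let ?p = "2 * (2 + a_exp N \<alpha>)" and ?c = "chi1 N \<alpha> a R"
  define m where "m = chi0 N \<alpha> a powr (- (2 + 2 * a_exp N \<alpha>))"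
  have m: "m \<ge> 0" by (simp add: m_def)
  have c: "?c > 0" using chi0_pos chi1_ge_chi0[OF R] by auto
  have b: "0 < a_exp N \<alpha>" by (rule a_exp_bounds)
  have sc: "source_const > 0" by (rule source_const_pos)
  have "?c\<^sup>2 \<le> (1 + ?c)\<^sup>2" using c by (intro power_mono) auto
  also have "\<dots> = (1 + ?c) powr 2" using c by simp
  also have "\<dots> \<le> (1 + ?c) powr ?p" using c b by (intro powr_mono) auto
  finally have 1: "?c\<^sup>2 \<le> (1 + ?c) powr ?p" .
  have d: "data_const = 1 + source_const + source_const * m" by (simp add: data_const_def m_def)
  have d1: "1 \<le> data_const" "source_const \<le> data_const" "source_const * m \<le> data_const"
    using sc m by (auto simp: d)
  have t1: "?c\<^sup>2 * (source_const * (M\<^sup>2 * u x t ^ 4))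
      \<le> data_const * ((1 + ?c) powr ?p * M\<^sup>2 * u x t ^ 4)"
  proof -
    have "source_const * ?c\<^sup>2 \<le> data_const * (1 + ?c) powr ?p"
      using d1 1 sc by (intro mult_mono) auto
    then have "source_const * ?c\<^sup>2 * (M\<^sup>2 * u x t ^ 4) \<le> data_const * (1 + ?c) powr ?p * (M\<^sup>2 * u x t ^ 4)"
      by (rule mult_right_mono) simp
    then show ?thesis by (simp add: mult_ac)
  qed
  have t2: "?c\<^sup>2 * (source_const * (norm (D\<Psi> x t))\<^sup>2) \<le> data_const * (?c powr ?p * (norm (D\<Psi> x t))\<^sup>2)"
  proof -
    have "source_const * ?c\<^sup>2 \<le> source_const * (m * ?c powr ?p)"
      using chi1_sq_le[OF R] sc by (intro mult_left_mono) (auto simp: m_def)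
    also have "\<dots> \<le> data_const * ?c powr ?p"
      using mult_right_mono[OF d1(3), of "?c powr ?p"] by (simp add: mult.assoc)
    finally have "source_const * ?c\<^sup>2 * (norm (D\<Psi> x t))\<^sup>2 \<le> data_const * ?c powr ?p * (norm (D\<Psi> x t))\<^sup>2"
      by (rule mult_right_mono) simp
    then show ?thesis by (simp add: mult_ac)
  qed
  have t3: "?c\<^sup>2 * (\<phi> * s) \<le> data_const * (?c\<^sup>2 * \<phi> * s)" if "s \<ge> 0" for s
    using mult_right_mono[OF d1(1), of "?c\<^sup>2 * \<phi> * s"] that \<phi> by (simp add: mult.assoc)
  have "?c\<^sup>2 * source x t = ?c\<^sup>2 * (source_const * (M\<^sup>2 * u x t ^ 4))
      + ?c\<^sup>2 * (source_const * (norm (D\<Psi> x t))\<^sup>2)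
      + ?c\<^sup>2 * (\<phi> * ((\<Psi>t x t)\<^sup>2 + (\<Psi> x t)\<^sup>2)) + ?c\<^sup>2 * (\<phi> * (u x t)\<^sup>2)"
    by (simp add: source_def algebra_simps)
  also have "\<dots> \<le> data_const * ((1 + ?c) powr ?p * M\<^sup>2 * u x t ^ 4)
      + data_const * (?c powr ?p * (norm (D\<Psi> x t))\<^sup>2)
      + data_const * (?c\<^sup>2 * \<phi> * ((\<Psi>t x t)\<^sup>2 + (\<Psi> x t)\<^sup>2)) + data_const * (?c\<^sup>2 * \<phi> * (u x t)\<^sup>2)"
    by (intro add_mono t1 t2 t3) auto
  finally show ?thesis by (simp add: data_energy_def algebra_simps)
qed

text \<open>The bracket of the first estimate, with its norms and the data term written as
  integrals.\<close>

definition data_total :: real where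
  "data_total = (chi1 N \<alpha> a R)\<^sup>2 * \<phi> * ((LINT x:U|lborel. (w x 0)\<^sup>2)
      + (LINT z:U\<times>{0<..<T}|lborel. (u (fst z) (snd z))\<^sup>2))
    + (1 + chi1 N \<alpha> a R) powr (2 * (2 + a_exp N \<alpha>)) * M\<^sup>2
        * (LINT z:U\<times>{0<..<T}|lborel. u (fst z) (snd z) ^ 4)
    + (LINT z:U\<times>{0<..<T}|lborel. data_energy (fst z) (snd z))"

lemma data_energy_nonneg: "0 \<le> data_energy x t"
  using \<phi> by (simp add: data_energy_def)

lemma data_total_nonneg: "0 \<le> data_total"
  unfolding data_total_def using \<phi> data_energy_nonneg
  by (intro add_nonneg_nonneg mult_nonneg_nonneg set_integral_nonneg) auto

lemma integrable_open_slab: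
  fixes f :: "real^3 \<Rightarrow> real \<Rightarrow> real"
  assumes "continuous_on (closure U \<times> {0..T}) (\<lambda>z. f (fst z) (snd z))"
  shows "set_integrable lborel (U \<times> {0<..<T}) (\<lambda>z. f (fst z) (snd z))"
  by (rule integrable_slab[OF assms order_refl]) auto

text \<open>Once \<open>chi1^2\<close> has moved into the bracket, the constant in front depends on
  \<open>N\<close>, \<open>\<alpha>\<close> and \<open>a\<close> alone.\<close>

lemma weighted_estimate:
  "(\<integral>\<^sup>+z\<in>U\<times>{0<..<T}. ennreal (weighted (fst z) (snd z)) \<partial>lborel)
    \<le> ennreal (4 * coercivity * data_const * data_total)"
proof (rule order_trans[OF energy_estimate], rule ennreal_leI)
  let ?p = "2 * (2 + a_exp N \<alpha>)" and ?c = "chi1 N \<alpha> a R"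
  let ?W = "LINT x:U|lborel. (w x 0)\<^sup>2"
  let ?I = "\<lambda>f. LINT z:U\<times>{0<..<T}|lborel. f (fst z) (snd z)"
  have c2: "continuous_on (closure U \<times> {0..T}) (\<lambda>z. (u (fst z) (snd z))\<^sup>2)"
    and c4: "continuous_on (closure U \<times> {0..T}) (\<lambda>z. u (fst z) (snd z) ^ 4)"
    by (intro continuous_intros cont_u)+
  note i = integrable_open_slab[OF cont_source] integrable_open_slab[OF c2] integrable_open_slab[OF c4]
    integrable_open_slab[OF cont_data_energy]
  have "?c\<^sup>2 * ?I source = (LINT z:U\<times>{0<..<T}|lborel. ?c\<^sup>2 * source (fst z) (snd z))"
    by simp
  also have "\<dots> \<le> (LINT z:U\<times>{0<..<T}|lborel. data_const * (?c\<^sup>2 * \<phi> * (u (fst z) (snd z))\<^sup>2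
      + (1 + ?c) powr ?p * M\<^sup>2 * u (fst z) (snd z) ^ 4 + data_energy (fst z) (snd z)))"
    using i source_le by (intro set_integral_mono set_integrable_mult_right set_integral_add) auto
  also have "\<dots> = data_const * (?c\<^sup>2 * \<phi> * ?I (\<lambda>x t. (u x t)\<^sup>2)
      + (1 + ?c) powr ?p * M\<^sup>2 * ?I (\<lambda>x t. u x t ^ 4) + ?I data_energy)"
    using i by (simp add: set_integral_add)
  finally have 1: "?c\<^sup>2 * ?I source \<le> \<dots>" .
  have W: "?W \<ge> 0"
    by (rule set_integral_nonneg) simp
  have "1 / 2 \<le> data_const" using source_const_pos by (simp add: data_const_def add_nonneg_nonneg)
  then have "1 / 2 * (?c\<^sup>2 * \<phi> * ?W) \<le> data_const * (?c\<^sup>2 * \<phi> * ?W)"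
    using W \<phi> by (intro mult_right_mono) auto
  with 1 have "?c\<^sup>2 * (\<phi> / 2 * ?W + ?I source) \<le> data_const * data_total"
    unfolding data_total_def by (simp add: algebra_simps)
  then have "4 * coercivity * (?c\<^sup>2 * (\<phi> / 2 * ?W + ?I source)) \<le> 4 * coercivity * (data_const * data_total)"
    using coercivity_pos by (intro mult_left_mono) auto
  then show "weight_const R * (\<phi> / 2 * ?W + ?I source) \<le> 4 * coercivity * data_const * data_total"
    by (simp add: weight_const_def mult.assoc)
qed

text \<open>The integrated form of \<open>powr_le_weighted_square\<close>. Its additive
  \<open>2\<close> integrates to \<open>2 |U| T\<close>: this is the origin of the term
  \<open>T\<close> in the second estimate and of the dependence of \<open>C\<close> on
  \<open>U\<close>.\<close>

lemma gradient_power_estimate: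
  "(\<integral>\<^sup>+z\<in>U\<times>{0<..<T}. ennreal (norm (Du (fst z) (snd z)) powr (2 - a_exp N \<alpha>)) \<partial>lborel)
    \<le> ennreal (2 * (4 * coercivity * data_const * data_total) + 2 * (measure lborel U * T)
        + 2 * (M\<^sup>2 * (LINT z:U\<times>{0<..<T}|lborel. u (fst z) (snd z) ^ 4)))"
proof -
  let ?S = "U \<times> {0<..<T}"
  let ?u4 = "\<lambda>z. u (fst z) (snd z) ^ 4"
  have S: "?S \<in> sets borel" using open_U by (intro borel_Times) auto
  have bS: "bounded ?S" using bounded_U by (intro bounded_Times) auto
  have c4: "continuous_on (closure U \<times> {0..T}) ?u4"
    by (intro continuous_intros cont_u)
  have "set_integrable lborel ?S (\<lambda>z. u (fst z) (snd z) ^ 4)"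
    using c4 by (rule integrable_open_slab)
  moreover have "set_integrable lborel ?S (\<lambda>z. 2 :: real)"
    using S bS by (intro set_integrable_bounded[where B = 2]) auto
  ultimately have int: "set_integrable lborel ?S (\<lambda>z. 2 + 2 * (M\<^sup>2 * ?u4 z))"
    by (intro set_integral_add set_integrable_mult_right)
  have measure_S: "measure lborel ?S = measure lborel U * T"
  proof -
    have "emeasure lborel ?S = emeasure lborel U * emeasure lborel {0<..<T}"
      unfolding lborel_prod[symmetric] using open_U by (intro lborel.emeasure_pair_measure_Times) auto
    then show ?thesis using T by (simp add: measure_def enn2real_mult)
  qed
  have meas: "(\<lambda>z. ennreal (weighted (fst z) (snd z)) * indicator ?S z) \<in> borel_measurable lborel"
  proof -
    have "continuous_on ?S (\<lambda>z. weighted (fst z) (snd z))"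
      using subset_closure by (intro continuous_on_subset[OF cont_weighted]) auto
    from borel_measurable_continuous_on_indicator[OF S this]
    have "(\<lambda>z. ennreal (indicator ?S z *\<^sub>R weighted (fst z) (snd z))) \<in> borel_measurable lborel" by simp
    also have "(\<lambda>z. ennreal (indicator ?S z *\<^sub>R weighted (fst z) (snd z)))
        = (\<lambda>z. ennreal (weighted (fst z) (snd z)) * indicator ?S z)"
      by (auto simp: fun_eq_iff split: split_indicator)
    finally show ?thesis .
  qed
  have meas2: "(\<lambda>z. ennreal (2 + 2 * (M\<^sup>2 * ?u4 z)) * indicator ?S z) \<in> borel_measurable lborel"
  proof -
    have "(\<lambda>z. ennreal (indicator ?S z *\<^sub>R (2 + 2 * (M\<^sup>2 * ?u4 z)))) \<in> borel_measurable lborel"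
      using borel_measurable_integrable[OF int[unfolded set_integrable_def]] by (rule measurable_compose) simp
    also have "(\<lambda>z. ennreal (indicator ?S z *\<^sub>R (2 + 2 * (M\<^sup>2 * ?u4 z))))
        = (\<lambda>z. ennreal (2 + 2 * (M\<^sup>2 * ?u4 z)) * indicator ?S z)"
      by (auto simp: fun_eq_iff split: split_indicator)
    finally show ?thesis .
  qed
  have "(\<integral>\<^sup>+z\<in>?S. ennreal (norm (Du (fst z) (snd z)) powr (2 - a_exp N \<alpha>)) \<partial>lborel)
      \<le> (\<integral>\<^sup>+z. 2 * (ennreal (weighted (fst z) (snd z)) * indicator ?S z)
            + ennreal (2 + 2 * (M\<^sup>2 * ?u4 z)) * indicator ?S z \<partial>lborel)"
  proof (intro nn_integral_mono)
    fix z
    show "ennreal (norm (Du (fst z) (snd z)) powr (2 - a_exp N \<alpha>)) * indicator ?S z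
      \<le> 2 * (ennreal (weighted (fst z) (snd z)) * indicator ?S z)
            + ennreal (2 + 2 * (M\<^sup>2 * ?u4 z)) * indicator ?S z"
    proof (cases "z \<in> ?S")
      case True
      then have Z: "norm (Z (fst z) (snd z)) \<le> M" using subset_closure by (intro Z_le) auto
      have "norm (Du (fst z) (snd z)) powr (2 - a_exp N \<alpha>)
          \<le> 2 * weighted (fst z) (snd z) + (2 + 2 * (M\<^sup>2 * ?u4 z))"
        using powr_le_weighted_square[OF Z, of "Du (fst z) (snd z)" "u (fst z) (snd z)"]
        by (simp add: weighted_def flux_def)
      then have "ennreal (norm (Du (fst z) (snd z)) powr (2 - a_exp N \<alpha>))
          \<le> ennreal (2 * weighted (fst z) (snd z) + (2 + 2 * (M\<^sup>2 * ?u4 z)))"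
        by (rule ennreal_leI)
      also have "\<dots> = ennreal (2 * weighted (fst z) (snd z)) + ennreal (2 + 2 * (M\<^sup>2 * ?u4 z))"
        using weighted_nonneg by (intro ennreal_plus) (simp_all add: add_nonneg_nonneg)
      finally show ?thesis using True by (simp add: ennreal_mult' weighted_nonneg)
    qed simp
  qed
  also have "\<dots> = 2 * (\<integral>\<^sup>+z\<in>?S. ennreal (weighted (fst z) (snd z)) \<partial>lborel)
      + (\<integral>\<^sup>+z\<in>?S. ennreal (2 + 2 * (M\<^sup>2 * ?u4 z)) \<partial>lborel)"
    using meas meas2 by (subst nn_integral_add) (auto simp: nn_integral_cmult)
  also have "(\<integral>\<^sup>+z\<in>?S. ennreal (2 + 2 * (M\<^sup>2 * ?u4 z)) \<partial>lborel)
      = ennreal (LINT z:?S|lborel. 2 + 2 * (M\<^sup>2 * ?u4 z))"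
    by (rule nn_integral_eq_LINT[OF int]) (auto intro!: add_nonneg_nonneg mult_nonneg_nonneg)
  also have "(LINT z:?S|lborel. 2 + 2 * (M\<^sup>2 * ?u4 z))
      = 2 * (measure lborel U * T) + 2 * (M\<^sup>2 * (LINT z:?S|lborel. ?u4 z))"
  proof -
    have "(LINT z:?S|lborel. 2 + 2 * (M\<^sup>2 * ?u4 z)) = (LINT z:?S|lborel. 2) + (LINT z:?S|lborel. 2 * (M\<^sup>2 * ?u4 z))"
      using \<open>set_integrable lborel ?S (\<lambda>z. 2 :: real)\<close> \<open>set_integrable lborel ?S ?u4\<close>
      by (intro set_integral_add set_integrable_mult_right)
    also have "(LINT z:?S|lborel. (2::real)) = 2 * measure lborel ?S"
      using S by (simp add: set_lebesgue_integral_def)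
    finally show ?thesis by (simp add: measure_S)
  qed
  also have "2 * (\<integral>\<^sup>+z\<in>?S. ennreal (weighted (fst z) (snd z)) \<partial>lborel)
      \<le> ennreal (2 * (4 * coercivity * data_const * data_total))"
  proof -
    have "2 * ennreal y = ennreal (2 * y)" for y by (simp add: ennreal_mult')
    then show ?thesis using mult_left_mono[OF weighted_estimate, of 2] by simp
  qed
  also have "ennreal (2 * (4 * coercivity * data_const * data_total))
      + ennreal (2 * (measure lborel U * T) + 2 * (M\<^sup>2 * (LINT z:?S|lborel. ?u4 z)))
      = ennreal (2 * (4 * coercivity * data_const * data_total)
        + (2 * (measure lborel U * T) + 2 * (M\<^sup>2 * (LINT z:?S|lborel. ?u4 z))))"
  proof (rule ennreal_plus[symmetric])
    show "0 \<le> 2 * (4 * coercivity * data_const * data_total)"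
      using coercivity_pos data_const_pos data_total_nonneg by simp
    have "0 \<le> (LINT z:?S|lborel. ?u4 z)"
      by (rule set_integral_nonneg) simp
    then show "0 \<le> 2 * (measure lborel U * T) + 2 * (M\<^sup>2 * (LINT z:?S|lborel. ?u4 z))"
      using T by (intro add_nonneg_nonneg mult_nonneg_nonneg) auto
  qed
  finally show ?thesis by (simp add: add.assoc)
qed

end

section \<open>Identification of the derivatives and fields of the statement\<close>

lemma grad_eq:
  assumes "GDERIV f x :> D"
  shows "grad f x = D"
  unfolding grad_def
proof (rule the_equality)
  show "GDERIV f x :> D" by (rule assms)
  fix D' assume "GDERIV f x :> D'"
  then have "(\<lambda>h. h \<bullet> D') = (\<lambda>h. h \<bullet> D)"
    using assms unfolding gderiv_def by (rule has_derivative_unique)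
  then have "(D' - D) \<bullet> (D' - D) = 0" by (simp add: inner_diff_right fun_eq_iff)
  then show "D' = D" by simp
qed

text \<open>A second point \<open>s\<close> of the connected set \<open>I\<close> makes
  \<open>t\<close> a limit point of \<open>I\<close>; this is what renders the one-sided derivative
  unique.\<close>

lemma time_deriv_eq:
  assumes der: "(f x has_real_derivative f') (at t within I)"
    and I: "connected I" "t \<in> I" "s \<in> I" "s \<noteq> t"
  shows "time_deriv I f x t = f'"
proof -
  have "t islimpt I" using I by (intro connected_imp_perfect) auto
  then have "at t within I \<noteq> bot" using trivial_limit_within by blast
  then show ?thesis
    unfolding time_deriv_def using der
    by (intro vector_derivative_within) (simp_all add: has_real_derivative_iff_has_vector_derivative)
qed

text \<open>The equation is stated with \<open>grad\<close>, which is known to equal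
  \<open>Du\<close> only inside \<open>U\<close>; the divergence depends on nothing else, being
  local.\<close>

lemma divergence_cong_open:
  assumes S: "open S" "x \<in> S" and eq: "\<And>y. y \<in> S \<Longrightarrow> V y = W y"
  shows "divergence V x = divergence W x"
proof -
  have "(V has_derivative D) (at x) \<longleftrightarrow> (W has_derivative D) (at x)" for D
    using has_derivative_transform_within_open[of V D x UNIV S W]
      has_derivative_transform_within_open[of W D x UNIV S V] S eq by auto
  then show ?thesis by (simp add: divergence_def frechet_derivative_def)
qed

lemma linear_J_op: "linear (J_op k)"
  by (rule linearI) (simp_all add: J_op_def cross_add_right cross_mult_right)

lemma Z_fun_has_derivative:
  "((\<lambda>y. Z_fun k G \<Omega> e0 y t) has_derivative (\<lambda>h. \<Omega>\<^sup>2 *\<^sub>R J_op k (J_op k h))) (at x)"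
proof -
  have "linear (\<lambda>h. \<Omega>\<^sup>2 *\<^sub>R J_op k (J_op k h))"
    using linear_J_op[of k] by (auto intro!: linearI simp: linear_add linear_cmul scaleR_add_right)
  then have "((\<lambda>h. \<Omega>\<^sup>2 *\<^sub>R J_op k (J_op k h)) has_derivative (\<lambda>h. \<Omega>\<^sup>2 *\<^sub>R J_op k (J_op k h))) (at x)"
    by (rule linear_imp_has_derivative)
  then have "((\<lambda>y. - (G *\<^sub>R e0 t) + \<Omega>\<^sup>2 *\<^sub>R J_op k (J_op k y)) has_derivative
      (\<lambda>h. 0 + \<Omega>\<^sup>2 *\<^sub>R J_op k (J_op k h))) (at x)"
    by (rule has_derivative_add[OF has_derivative_const])
  then show ?thesis by (simp add: Z_fun_def)
qed

lemma continuous_on_Z_fun: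
  assumes "smooth_curve e0"
  shows "continuous_on S (\<lambda>z. Z_fun k G \<Omega> e0 (fst z) (snd z))"
proof -
  obtain D :: "nat \<Rightarrow> real \<Rightarrow> real^3" where "D 0 = e0"
    and D: "\<And>n t. (D n has_vector_derivative D (Suc n) t) (at t)"
    using assms unfolding smooth_curve_def by blast
  then have "isCont e0 t" for t using D[of 0 t] has_vector_derivative_continuous by metis
  then have e0: "continuous_on UNIV e0" by (simp add: continuous_at_imp_continuous_on)
  have J: "continuous_on UNIV (J_op k)"
    using linear_J_op by (rule linear_continuous_on_compose[OF continuous_on_id])
  show ?thesis
    unfolding Z_fun_def
    by (intro continuous_intros continuous_on_compose2[OF e0] continuous_on_compose2[OF J]) auto
qed

text \<open>A real supremum is an upper bound only for a set that is bounded above; here compactness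
  of the closed cylinder provides this.\<close>

lemma norm_le_M_Z:
  assumes U: "bounded U" and e0: "smooth_curve e0" and xt: "x \<in> closure U" "t \<in> {0..T}"
  shows "norm (Z_fun k G \<Omega> e0 x t) \<le> M_Z U T (Z_fun k G \<Omega> e0)"
proof -
  let ?f = "\<lambda>(x, t). norm (Z_fun k G \<Omega> e0 x t)"
  have "continuous_on (closure U \<times> {0..T}) ?f"
    unfolding case_prod_unfold by (intro continuous_on_norm continuous_on_Z_fun e0)
  moreover have "compact (closure U \<times> {0..T})"
    using U by (intro compact_Times) (auto simp: compact_closure)
  ultimately have "bounded (?f ` (closure U \<times> {0..T}))"
    by (intro compact_imp_bounded compact_continuous_image)
  then have "bdd_above (?f ` (closure U \<times> {0..T}))" by (rule bounded_imp_bdd_above)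
  from cSUP_upper[OF _ this, of "(x, t)"] xt show ?thesis by (simp add: M_Z_def)
qed

theorem proposition5p1:
  fixes N :: nat and \<alpha> a :: "nat \<Rightarrow> real" and U :: "(real^3) set"
  assumes "N \<ge> 1"
    and "\<alpha> 0 = 0" and "strict_mono_on {..N} \<alpha>"
    and "\<forall>i\<le>N. a i > 0"
    and "U \<noteq> {}" and "open U" and "bounded U" and "C1_boundary U"
  shows "\<exists>C>0. \<forall>(k :: real^3) (R :: real) (T :: real) (\<phi> :: real) (G :: real) (\<Omega> :: real)
      (e0 :: real \<Rightarrow> real^3) (u :: real^3 \<Rightarrow> real \<Rightarrow> real) (u0 :: real^3 \<Rightarrow> real)
      (\<psi> :: real^3 \<Rightarrow> real \<Rightarrow> real) (\<Psi> :: real^3 \<Rightarrow> real \<Rightarrow> real).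
    norm k = 1 \<and> R \<ge> 0 \<and> T > 0 \<and> \<phi> > 0 \<and> G > 0 \<and> \<Omega> \<ge> 0 \<and>
    smooth_curve e0 \<and> (\<forall>t. norm (e0 t) = 1) \<and>
    classical_solution U T \<phi> (X_fun N \<alpha> a k R) (Z_fun k G \<Omega> e0) u0 \<psi> u \<and>
    C1_cylinder U {0..T} \<Psi> \<and> (\<forall>x\<in>frontier U. \<forall>t\<in>{0<..T}. \<Psi> x t = \<psi> x t)
    \<longrightarrow>
    (let b = a_exp N \<alpha>;
         c1 = chi1 N \<alpha> a R;
         Z = Z_fun k G \<Omega> e0;
         M = M_Z U T Z;
         ubar0 = (\<lambda>x. u0 x - \<Psi> x 0);
         nu0 = L_norm 2 U ubar0;
         nu2 = L_norm 2 (U \<times> {0<..<T}) (\<lambda>(x, t). u x t);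
         nu4 = L_norm 4 (U \<times> {0<..<T}) (\<lambda>(x, t). u x t);
         E = E0_data U T \<phi> b c1 \<Psi>
     in
       (\<integral>\<^sup>+t\<in>{0<..<T}. (\<integral>\<^sup>+x\<in>U.
            ennreal (K_weight b Z u x t * (norm (grad (\<lambda>y. u y t) x))\<^sup>2) \<partial>lborel) \<partial>lborel)
         \<le> ennreal (C * (c1\<^sup>2 * \<phi> * (nu0\<^sup>2 + nu2\<^sup>2)
              + (1 + c1) powr (2 * (2 + b)) * M\<^sup>2 * nu4 ^ 4 + E)) \<and>
       (\<integral>\<^sup>+t\<in>{0<..<T}. (\<integral>\<^sup>+x\<in>U.
            ennreal (norm (grad (\<lambda>y. u y t) x) powr (2 - b)) \<partial>lborel) \<partial>lborel)
         \<le> ennreal (C * (c1\<^sup>2 * \<phi> * (nu0\<^sup>2 + nu2\<^sup>2)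
              + (1 + c1) powr (2 * (2 + b)) * (T + M\<^sup>2 * nu4 ^ 4) + E)))"
proof -
  interpret forchheimer N \<alpha> a using assms by unfold_locales auto
  define C1 where "C1 = 4 * coercivity * data_const"
  \<comment> \<open>The \<open>2 * C1\<close> comes from the doubled weighted integral, the
    \<open>2\<close> absorbs the fourth power of \<open>u\<close>, and \<open>2 |U|\<close> absorbs
    the term with \<open>T\<close>.\<close>
  define C where "C = 2 * C1 + 2 + 2 * measure lborel U"
  have C1: "C1 > 0" using coercivity_pos data_const_pos by (simp add: C1_def)
  have C: "C > 0" using C1 by (simp add: C_def add_pos_nonneg)
  show ?thesis
  proof (intro exI[of _ C] conjI C allI impI, goal_cases)
    case (1 k R T \<phi> G \<Omega> e0 u u0 \<psi> \<Psi>)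
    define Z where "Z = Z_fun k G \<Omega> e0"
    define M where "M = M_Z U T Z"
    let ?b = "a_exp N \<alpha>" and ?c = "chi1 N \<alpha> a R"
    from 1 have k: "norm k = 1" and R: "R \<ge> 0" and T: "T > 0" and \<phi>: "\<phi> > 0" and e0: "smooth_curve e0"
      and sol: "classical_solution U T \<phi> (X k R) Z u0 \<psi> u" and \<Psi>: "C1_cylinder U {0..T} \<Psi>"
      and \<Psi>_bd: "\<And>x t. x \<in> frontier U \<Longrightarrow> t \<in> {0<..T} \<Longrightarrow> \<Psi> x t = \<psi> x t"
      by (auto simp: Z_def)
    from sol obtain Du D2u ut where
      cont_u: "continuous_on (closure U \<times> {0..T}) (\<lambda>(x, t). u x t)"
      and der_u: "\<forall>x\<in>U. \<forall>t\<in>{0<..T}. GDERIV (\<lambda>y. u y t) x :> Du x t \<and>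
           ((\<lambda>y. Du y t) has_derivative (\<lambda>h. D2u x t *v h)) (at x) \<and>
           (u x has_real_derivative ut x t) (at t within {0<..T})"
      and cont_Du: "continuous_on (closure U \<times> {0<..T}) (\<lambda>(x, t). Du x t)"
      and cont_D2u: "continuous_on (closure U \<times> {0<..T}) (\<lambda>(x, t). D2u x t)"
      and cont_ut: "continuous_on (closure U \<times> {0<..T}) (\<lambda>(x, t). ut x t)"
      and pde: "\<forall>x\<in>U. \<forall>t\<in>{0<..T}.
        \<phi> * time_deriv {0<..T} u x t = divergence (\<lambda>y. X k R (flux_arg Z u y t)) x"
      and init: "\<forall>x\<in>U. u x 0 = u0 x"
      and bd: "\<forall>x\<in>frontier U. \<forall>t\<in>{0<..T}. u x t = \<psi> x t"
      unfolding classical_solution_def C21_cylinder_def by blast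
    from \<Psi> obtain D\<Psi> \<Psi>t where
      cont_\<Psi>: "continuous_on (closure U \<times> {0..T}) (\<lambda>(x, t). \<Psi> x t)"
      and der_\<Psi>: "\<forall>x\<in>U. \<forall>t\<in>{0..T}. GDERIV (\<lambda>y. \<Psi> y t) x :> D\<Psi> x t \<and>
           (\<Psi> x has_real_derivative \<Psi>t x t) (at t within {0..T})"
      and cont_D\<Psi>: "continuous_on (closure U \<times> {0..T}) (\<lambda>(x, t). D\<Psi> x t)"
      and cont_\<Psi>t: "continuous_on (closure U \<times> {0..T}) (\<lambda>(x, t). \<Psi>t x t)"
      unfolding C1_cylinder_def by blast
    have grad_u: "grad (\<lambda>y. u y t) x = Du x t" if "x \<in> U" "t \<in> {0<..T}" for x t
      using der_u that by (intro grad_eq) auto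
    have grad_\<Psi>: "grad (\<lambda>y. \<Psi> y t) x = D\<Psi> x t" if "x \<in> U" "t \<in> {0..T}" for x t
      using der_\<Psi> that by (intro grad_eq) auto
    \<comment> \<open>The witness \<open>s\<close> only has to be another point of the interval:
      \<open>T\<close>, or \<open>T / 2\<close> when \<open>t = T\<close>.\<close>
    have td_u: "time_deriv {0<..T} u x t = ut x t" if "x \<in> U" "t \<in> {0<..T}" for x t
      using der_u that T
      by (intro time_deriv_eq[where s = "if t = T then T / 2 else T"]) auto
    have td_\<Psi>: "time_deriv {0..T} \<Psi> x t = \<Psi>t x t" if "x \<in> U" "t \<in> {0..T}" for x t
      using der_\<Psi> that T
      by (intro time_deriv_eq[where s = "if t = T then T / 2 else T"]) auto
    have flux_arg: "flux_arg Z u x t = Du x t + (u x t)\<^sup>2 *\<^sub>R Z x t" if "x \<in> U" "t \<in> {0<..T}" for x t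
      using grad_u[OF that] by (simp add: flux_arg_def)
    interpret dirichlet_flow N \<alpha> a U k R T \<phi> M Z "\<lambda>h. \<Omega>\<^sup>2 *\<^sub>R J_op k (J_op k h)" u ut \<Psi> \<Psi>t Du D\<Psi> D2u
    proof
      show "negligible (frontier U)" using assms by (intro C1_boundary_imp_negligible_frontier)
      show "continuous_on (closure U \<times> {0..T}) (\<lambda>z. Z (fst z) (snd z))"
        unfolding Z_def by (rule continuous_on_Z_fun[OF e0])
      show "((\<lambda>y. Z y t) has_derivative (\<lambda>h. \<Omega>\<^sup>2 *\<^sub>R J_op k (J_op k h))) (at x)" for x t
        unfolding Z_def by (rule Z_fun_has_derivative)
      show "norm (Z x t) \<le> M" if "x \<in> closure U" "t \<in> {0..T}" for x t
        unfolding M_def Z_def using assms that by (intro norm_le_M_Z e0)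
      show "\<phi> * ut x t = divergence (\<lambda>y. X k R (Du y t + (u y t)\<^sup>2 *\<^sub>R Z y t)) x"
        if "x \<in> U" "t \<in> {0<..T}" for x t
      proof -
        have "\<phi> * ut x t = divergence (\<lambda>y. X k R (flux_arg Z u y t)) x"
          using pde that td_u[OF that] by metis
        also have "\<dots> = divergence (\<lambda>y. X k R (Du y t + (u y t)\<^sup>2 *\<^sub>R Z y t)) x"
          using that assms flux_arg by (intro divergence_cong_open[of U]) auto
        finally show ?thesis .
      qed
      show "u x t = \<Psi> x t" if "x \<in> frontier U" "t \<in> {0<..T}" for x t
        using bd \<Psi>_bd that by simp
    qed (use assms k R T \<phi> cont_u cont_Du cont_D2u cont_ut cont_\<Psi> cont_D\<Psi> cont_\<Psi>t der_u der_\<Psi>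
          in \<open>auto simp: case_prod_unfold\<close>)
    define nu0 where "nu0 = L_norm 2 U (\<lambda>x. u0 x - \<Psi> x 0)"
    define nu2 where "nu2 = L_norm 2 (U \<times> {0<..<T}) (\<lambda>(x, t). u x t)"
    define nu4 where "nu4 = L_norm 4 (U \<times> {0<..<T}) (\<lambda>(x, t). u x t)"
    define E where "E = E0_data U T \<phi> ?b ?c \<Psi>"
    define p where "p = (1 + ?c) powr (2 * (2 + ?b))"
    have U: "U \<in> sets borel" "U \<in> sets lborel" using assms by auto
    have nu0: "nu0\<^sup>2 = (LINT x:U|lborel. (w x 0)\<^sup>2)"
      unfolding nu0_def L_norm_2_sq using U init by (intro set_lebesgue_integral_cong) (auto simp: w_def)
    have nu2: "nu2\<^sup>2 = (LINT z:U\<times>{0<..<T}|lborel. (u (fst z) (snd z))\<^sup>2)"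
      by (simp add: nu2_def L_norm_2_sq case_prod_unfold)
    have nu4: "nu4 ^ 4 = (LINT z:U\<times>{0<..<T}|lborel. u (fst z) (snd z) ^ 4)"
      by (simp add: nu4_def L_norm_4_pow4 case_prod_unfold)
    have E: "E = (LINT z:U\<times>{0<..<T}|lborel. data_energy (fst z) (snd z))"
    proof -
      have "E = (LINT t:{0<..<T}|lborel. (LINT x:U|lborel. data_energy x t))"
        unfolding E_def E0_data_def
        using U grad_\<Psi> td_\<Psi>
        by (intro set_lebesgue_integral_cong allI impI) (auto simp: data_energy_def)
      then show ?thesis
        using cylinder_Fubini(1)[OF integrable_open_slab[OF cont_data_energy]] by simp
    qed
    have E_nonneg: "E \<ge> 0" unfolding E using data_energy_nonneg by (intro set_integral_nonneg) auto
    have total: "data_total = ?c\<^sup>2 * \<phi> * (nu0\<^sup>2 + nu2\<^sup>2) + p * M\<^sup>2 * nu4 ^ 4 + E"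
      by (simp add: data_total_def nu0 nu2 nu4 E p_def)
    have c: "?c > 0" using chi0_pos chi1_ge_chi0[OF R] by simp
    have p: "p \<ge> 1" using c a_exp_bounds by (auto simp: p_def intro!: ge_one_powr_ge_zero)
    have est1: "(\<integral>\<^sup>+t\<in>{0<..<T}. (\<integral>\<^sup>+x\<in>U.
            ennreal (K_weight ?b Z u x t * (norm (grad (\<lambda>y. u y t) x))\<^sup>2) \<partial>lborel) \<partial>lborel)
         \<le> ennreal (C * (?c\<^sup>2 * \<phi> * (nu0\<^sup>2 + nu2\<^sup>2) + p * M\<^sup>2 * nu4 ^ 4 + E))"
    proof -
      have "(\<integral>\<^sup>+t\<in>{0<..<T}. (\<integral>\<^sup>+x\<in>U.
            ennreal (K_weight ?b Z u x t * (norm (grad (\<lambda>y. u y t) x))\<^sup>2) \<partial>lborel) \<partial>lborel)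
          = (\<integral>\<^sup>+t\<in>{0<..<T}. (\<integral>\<^sup>+x\<in>U. ennreal (weighted x t) \<partial>lborel) \<partial>lborel)"
      proof (intro set_nn_integral_cong refl)
        fix t x assume "t \<in> space lborel \<inter> {0<..<T}" "x \<in> space lborel \<inter> U"
        then show "ennreal (K_weight ?b Z u x t * (norm (grad (\<lambda>y. u y t) x))\<^sup>2) = ennreal (weighted x t)"
          by (simp add: K_weight_def weighted_def flux_def flux_arg grad_u)
      qed
      also have "\<dots> = (\<integral>\<^sup>+z\<in>U\<times>{0<..<T}. ennreal (weighted (fst z) (snd z)) \<partial>lborel)"
        using U subset_closure
        by (intro cylinder_nn_integral continuous_on_subset[OF cont_weighted]) auto
      also have "\<dots> \<le> ennreal (C1 * data_total)"
        using weighted_estimate by (simp add: C1_def)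
      also have "\<dots> \<le> ennreal (C * data_total)"
        using data_total_nonneg C1 by (intro ennreal_leI mult_right_mono) (auto simp: C_def)
      finally show ?thesis by (simp add: total)
    qed
    have est2: "(\<integral>\<^sup>+t\<in>{0<..<T}. (\<integral>\<^sup>+x\<in>U.
            ennreal (norm (grad (\<lambda>y. u y t) x) powr (2 - ?b)) \<partial>lborel) \<partial>lborel)
         \<le> ennreal (C * (?c\<^sup>2 * \<phi> * (nu0\<^sup>2 + nu2\<^sup>2) + p * (T + M\<^sup>2 * nu4 ^ 4) + E))"
    proof -
      have "continuous_on (closure U \<times> {0<..T}) (\<lambda>z. norm (Du (fst z) (snd z)) powr (2 - ?b))"
        using cont_Du a_exp_bounds
        by (intro continuous_on_powr' continuous_intros) (auto simp: case_prod_unfold)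
      then have cont: "continuous_on (U \<times> {0<..<T}) (\<lambda>z. norm (Du (fst z) (snd z)) powr (2 - ?b))"
        by (rule continuous_on_subset) (use subset_closure in auto)
      have "(\<integral>\<^sup>+t\<in>{0<..<T}. (\<integral>\<^sup>+x\<in>U.
            ennreal (norm (grad (\<lambda>y. u y t) x) powr (2 - ?b)) \<partial>lborel) \<partial>lborel)
          = (\<integral>\<^sup>+t\<in>{0<..<T}. (\<integral>\<^sup>+x\<in>U. ennreal (norm (Du x t) powr (2 - ?b)) \<partial>lborel) \<partial>lborel)"
      proof (intro set_nn_integral_cong refl)
        fix t x assume "t \<in> space lborel \<inter> {0<..<T}" "x \<in> space lborel \<inter> U"
        then show "ennreal (norm (grad (\<lambda>y. u y t) x) powr (2 - ?b)) = ennreal (norm (Du x t) powr (2 - ?b))"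
          by (simp add: grad_u)
      qed
      also have "\<dots> = (\<integral>\<^sup>+z\<in>U\<times>{0<..<T}. ennreal (norm (Du (fst z) (snd z)) powr (2 - ?b)) \<partial>lborel)"
        using U cont by (intro cylinder_nn_integral) auto
      also have "\<dots> \<le> ennreal (2 * (C1 * data_total) + 2 * (measure lborel U * T) + 2 * (M\<^sup>2 * nu4 ^ 4))"
        using gradient_power_estimate by (simp add: C1_def nu4 mult.assoc)
      also have "\<dots> \<le> ennreal (C * (data_total + p * T))"
      proof (rule ennreal_leI)
        have "0 \<le> ?c\<^sup>2 * \<phi> * (nu0\<^sup>2 + nu2\<^sup>2)" using \<phi> by simp
        \<comment> \<open>The fourth-power term, and below also \<open>T\<close>, arrive without the
          factor \<open>p\<close>; they may be given it because \<open>1 + chi1 \<ge> 1\<close>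
          makes \<open>p \<ge> 1\<close>.\<close>
        moreover have "M\<^sup>2 * nu4 ^ 4 \<le> p * (M\<^sup>2 * nu4 ^ 4)"
          using mult_right_mono[OF p, of "M\<^sup>2 * nu4 ^ 4"] by simp
        ultimately have 1: "2 * (M\<^sup>2 * nu4 ^ 4) \<le> 2 * data_total"
          using E_nonneg by (simp add: total mult.assoc)
        have "2 * measure lborel U * T \<le> C * (p * T)"
        proof (rule mult_mono)
          show "2 * measure lborel U \<le> C" using C1 by (simp add: C_def)
          show "T \<le> p * T" using mult_right_mono[OF p, of T] T by simp
        qed (use C T in auto)
        moreover have "0 \<le> 2 * measure lborel U * data_total" using data_total_nonneg by simp
        ultimately show "2 * (C1 * data_total) + 2 * (measure lborel U * T) + 2 * (M\<^sup>2 * nu4 ^ 4)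
            \<le> C * (data_total + p * T)"
          using 1 by (simp add: C_def algebra_simps)
      qed
      also have "data_total + p * T = ?c\<^sup>2 * \<phi> * (nu0\<^sup>2 + nu2\<^sup>2) + p * (T + M\<^sup>2 * nu4 ^ 4) + E"
        by (simp add: total algebra_simps)
      finally show ?thesis .
    qed
    show ?case
      using est1 est2 unfolding Let_def nu0_def nu2_def nu4_def E_def p_def M_def Z_def by (intro conjI)
  qed
qed

end
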